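(* Let $\mathcal{C}$ be a category with pullbacks, let $(A,S)$ and $(X,T)$ be categories in $\mathcal{C}$ (monads in $\mathrm{Span}(\mathcal{C})$), let $f:X\to A$ and $u:A\to X$ be morphisms of $\mathcal{C}$, and let $(u_{\star},f^{\star},\pi)$ be an adjunction core, i.e. $\pi:f^{\star}S\to Tu_{\star}$ is an invertible 2-cell in $\mathrm{Span}(\mathcal{C})$. Define 2-cells of $\mathrm{Span}(\mathcal{C})$ $$\bar\beta=\pi\cdot f^{\star}\eta:f^{\star}\to Tu_{\star},\qquad \bar\alpha=\pi^{-1}\cdot\eta u_{\star}:u_{\star}\to f^{\star}S,$$ $$\upsilon=\pi\cdot f^{\star}\mu\cdot\bar\alpha S:u_{\star}S\to Tu_{\star},\qquad \psi=\pi^{-1}\cdot\mu u_{\star}\cdot T\bar\beta:Tf^{\star}\to f^{\star}S.$$ Then the core extends to an adjunction $(f_{\star},\phi)\dashv(u_{\star},\upsilon)$ in $\mathrm{Cat}(\mathcal{C})$ if and only if at least one of the following two conditions holds: (I) $\ \mu u_{\star}\cdot T\upsilon\cdot\pi S=\pi\cdot f^{\star}\mu:\ f^{\star}SS\to Tu_{\star}$; (II) $\ f^{\star}\mu\cdot\psi S\cdot T\pi^{-1}=\pi^{-1}\cdot\mu u_{\star}:\ TTu_{\star}\to f^{\star}S$. The adjunction is unique when it exists.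
   Context: Associativity and unit constraints of bicategories are suppressed; juxtaposition is horizontal composition ($gf$ means $f$ first) and $\cdot$ is vertical composition. $\mathrm{Span}(\mathcal{C})$ is the bicategory with the objects of $\mathcal{C}$; morphisms $U\to V$ are spans $(s_0,S,s_1)$, $U\xleftarrow{s_0}S\xrightarrow{s_1}V$; 2-cells $(s_0,S,s_1)\to(t_0,T,t_1)$ are morphisms $r:S\to T$ in $\mathcal{C}$ with $t_0r=s_0$, $t_1r=s_1$; the composite of $(s_0,S,s_1):U\to V$ followed by $(t_0,T,t_1):V\to W$ is $(s_0p,P,t_1q)$ where $P$, with projections $p:P\to S$ and $q:P\to T$, is the pullback of $s_1$ and $t_0$. A morphism $f:U\to V$ of $\mathcal{C}$ gives spans $f_{\star}=(1_U,U,f):U\to V$ and $f^{\star}=(f,U,1_U):V\to U$ with $f_{\star}\dashv f^{\star}$ in $\mathrm{Span}(\mathcal{C})$; write $\eta_f,\varepsilon_f$ for its unit and counit. A category in $\mathcal{C}$ is a monad $(A,S)$ in $\mathrm{Span}(\mathcal{C})$: an object $A$, a span $S=(s_0,S,s_1):A\to A$ and 2-cells $\eta:1_A\to S$ (identities), $\mu:SS\to S$ (composition) satisfying associativity and unit laws; $\eta,\mu$ denote the unit and multiplication of every monad. A functor $(X,T)\to(A,S)$ is a monad opmorphism of the form $(f_{\star},\phi)$ with $f:X\to A$ in $\mathcal{C}$: a 2-cell $\phi:f_{\star}T\to Sf_{\star}$ with $\mu f_{\star}\cdot S\phi\cdot\phi T=\phi\cdot f_{\star}\mu$ and $\phi\cdot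 f_{\star}\eta=\eta f_{\star}$. A natural transformation $(f_{\star},\phi)\to(g_{\star},\gamma)$ between functors $(X,T)\to(A,S)$ is a 2-cell between them in $\mathrm{KL}(\mathrm{Span}(\mathcal{C}))$: a 2-cell $\rho:f_{\star}\to Sg_{\star}$ in $\mathrm{Span}(\mathcal{C})$ with $\mu g_{\star}\cdot S\rho\cdot\phi=\mu g_{\star}\cdot S\gamma\cdot\rho T$. (With this direction of 2-cells, $s_1$ is read as the source and $s_0$ as the target of a morphism, so that $\pi$ encodes bijections $A(fx,a)\cong X(x,ua)$.) These form $\mathrm{Cat}(\mathcal{C})$, with compositions as follows: functors compose by $(f'_{\star},\phi')(f_{\star},\phi)=(f'_{\star}f_{\star},\phi'f_{\star}\cdot f'_{\star}\phi)$, where $f'_{\star}f_{\star}$ is identified with $(f'f)_{\star}$; the vertical composite of $\rho:(f_{\star},\phi)\to(g_{\star},\gamma)$ and $\tau:(g_{\star},\gamma)\to(h_{\star},\theta)$ is $\mu h_{\star}\cdot S\tau\cdot\rho$, with identities $\eta f_{\star}$; the horizontal composite of $\rho$ with $\rho':(f'_{\star},\phi')\to(g'_{\star},\gamma'):(A,S)\to(A',S')$ is $\mu g'_{\star}g_{\star}\cdot S'\rho'g_{\star}\cdot\phi'g_{\star}\cdot f'_{\star}\rho$. Explicitly, an adjunction $(f_{\star},\phi)\dashv(u_{\star},\upsilon):(A,S)\to(X,T)$ in $\mathrm{Cat}(\mathcal{C})$ consists of functors $(u_{\star},\upsilon):(A,S)\to(X,T)$, $(f_{\star},\phi):(X,T)\to(A,S)$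 and 2-cells $\alpha:f_{\star}u_{\star}\to S$ (counit), $\beta:1_X\to Tu_{\star}f_{\star}$ (unit) in $\mathrm{Span}(\mathcal{C})$ with (1) $\mu\cdot\alpha S=\mu\cdot S\alpha\cdot\phi u_{\star}\cdot f_{\star}\upsilon$; (2) $\mu u_{\star}f_{\star}\cdot T\beta=\mu u_{\star}f_{\star}\cdot T\upsilon f_{\star}\cdot Tu_{\star}\phi\cdot\beta T$; (3) $\eta f_{\star}=\mu f_{\star}\cdot S\alpha f_{\star}\cdot\phi u_{\star}f_{\star}\cdot f_{\star}\beta$; (4) $\eta u_{\star}=\mu u_{\star}\cdot T\upsilon\cdot Tu_{\star}\alpha\cdot\beta u_{\star}$. Such an adjunction has an associated core $(u_{\star},f^{\star},\pi)$ with $\pi=\mu u_{\star}\cdot T\upsilon\cdot Tu_{\star}\varepsilon_fS\cdot\beta f^{\star}S$ (which is invertible). A core $(u_{\star},f^{\star},\pi)$ extends to an adjunction if it is the associated core of an adjunction in $\mathrm{Cat}(\mathcal{C})$ with underlying morphisms $f$ and $u$; uniqueness means $\phi,\upsilon,\alpha,\beta$ are determined by the core. *)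

theory Defs
  imports Main
begin

section \<open>Categories with pullbacks\<close>

record ('o, 'a) category =
  Obj :: "'o set"
  Arr :: "'a set"
  Dom :: "'a \<Rightarrow> 'o"
  Cod :: "'a \<Rightarrow> 'o"
  Id :: "'o \<Rightarrow> 'a"
  Comp :: "'a \<Rightarrow> 'a \<Rightarrow> 'a"  (infixr "\<bullet>\<index>" 75)

text \<open>The two last fields hold a choice of projections for the pullback of each cospan;
  horizontal composition of spans is formed with this choice.\<close>

record ('o, 'a) pb_category = "('o, 'a) category" +
  Proj0 :: "'a \<Rightarrow> 'a \<Rightarrow> 'a"
  Proj1 :: "'a \<Rightarrow> 'a \<Rightarrow> 'a"

definition hom :: "('o, 'a, 'm) category_scheme \<Rightarrow> 'o \<Rightarrow> 'o \<Rightarrow> 'a set" where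
  "hom C U V = {f \<in> Arr C. Dom C f = U \<and> Cod C f = V}"

definition is_pullback :: "('o, 'a, 'm) category_scheme \<Rightarrow> 'a \<Rightarrow> 'a \<Rightarrow> 'a \<Rightarrow> 'a \<Rightarrow> bool" where
  "is_pullback C s t p q \<longleftrightarrow>
     p \<in> hom C (Dom C p) (Dom C s) \<and> q \<in> hom C (Dom C p) (Dom C t) \<and> s \<bullet> p = t \<bullet> q \<and>
     (\<forall>W \<in> Obj C. \<forall>a \<in> hom C W (Dom C s). \<forall>b \<in> hom C W (Dom C t). s \<bullet> a = t \<bullet> b \<longrightarrow>
        (\<exists>!h. h \<in> hom C W (Dom C p) \<and> p \<bullet> h = a \<and> q \<bullet> h = b))" for C (structure)

locale category =
  fixes C :: "('o, 'a, 'm) category_scheme" (structure)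
  assumes Dom_in_Obj: "f \<in> Arr C \<Longrightarrow> Dom C f \<in> Obj C"
    and Cod_in_Obj: "f \<in> Arr C \<Longrightarrow> Cod C f \<in> Obj C"
    and Id_in_hom: "U \<in> Obj C \<Longrightarrow> Id C U \<in> hom C U U"
    and Comp_in_hom: "f \<in> hom C U V \<Longrightarrow> g \<in> hom C V W \<Longrightarrow> g \<bullet> f \<in> hom C U W"
    and Comp_Id: "f \<in> hom C U V \<Longrightarrow> f \<bullet> Id C U = f"
    and Id_Comp: "f \<in> hom C U V \<Longrightarrow> Id C V \<bullet> f = f"
    and Comp_assoc: "f \<in> hom C U V \<Longrightarrow> g \<in> hom C V W \<Longrightarrow> h \<in> hom C W Z \<Longrightarrow>
      (h \<bullet> g) \<bullet> f = h \<bullet> (g \<bullet> f)"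

locale category_with_pullbacks = category C
  for C :: "('o, 'a, 'm) pb_category_scheme" (structure) +
  assumes pullback: "s \<in> Arr C \<Longrightarrow> t \<in> Arr C \<Longrightarrow> Cod C s = Cod C t \<Longrightarrow>
    is_pullback C s t (Proj0 C s t) (Proj1 C s t)"


section \<open>The bicategory of spans\<close>

text \<open>The apex of a span is the common domain of its legs. A 2-cell carries its source and target
  spans, so that equality of 2-cells includes equality of their boundaries.\<close>

datatype 'a span = Span (leg0: 'a) (leg1: 'a)

datatype 'a cell = Cell (src: "'a span") (arr: 'a) (tgt: "'a span")

definition apex :: "('o, 'a, 'm) category_scheme \<Rightarrow> 'a span \<Rightarrow> 'o" where
  "apex C S = Dom C (leg0 S)"

definition spans :: "('o, 'a, 'm) category_scheme \<Rightarrow> 'o \<Rightarrow> 'o \<Rightarrow> 'a span set" where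
  "spans C U V = {S. leg0 S \<in> hom C (apex C S) U \<and> leg1 S \<in> hom C (apex C S) V}"

text \<open>Meaningful for parallel \<open>S\<close> and \<open>T\<close>; that these are spans between the same objects is not part
  of the definition.\<close>

definition cells :: "('o, 'a, 'm) category_scheme \<Rightarrow> 'a span \<Rightarrow> 'a span \<Rightarrow> 'a cell set" where
  "cells C S T = {r. src r = S \<and> tgt r = T \<and> arr r \<in> hom C (apex C S) (apex C T) \<and>
     leg0 T \<bullet> arr r = leg0 S \<and> leg1 T \<bullet> arr r = leg1 S}" for C (structure)

definition vcomp :: "('o, 'a, 'm) category_scheme \<Rightarrow> 'a cell \<Rightarrow> 'a cell \<Rightarrow> 'a cell"
    (infixr "\<cdot>\<index>" 55) where
  "r' \<cdot> r = Cell (src r) (arr r' \<bullet> arr r) (tgt r')" for C (structure)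

definition id_cell :: "('o, 'a, 'm) category_scheme \<Rightarrow> 'a span \<Rightarrow> 'a cell" where
  "id_cell C S = Cell S (Id C (apex C S)) S"

definition inverse_cells :: "('o, 'a, 'm) category_scheme \<Rightarrow> 'a cell \<Rightarrow> 'a cell \<Rightarrow> bool" where
  "inverse_cells C r r' \<longleftrightarrow> r \<in> cells C (src r) (tgt r) \<and> r' \<in> cells C (tgt r) (src r) \<and>
     r' \<cdot> r = id_cell C (src r) \<and> r \<cdot> r' = id_cell C (tgt r)" for C (structure)

definition invertible_cell :: "('o, 'a, 'm) category_scheme \<Rightarrow> 'a cell \<Rightarrow> bool" where
  "invertible_cell C r \<longleftrightarrow> (\<exists>r'. inverse_cells C r r')"

definition inv_cell :: "('o, 'a, 'm) category_scheme \<Rightarrow> 'a cell \<Rightarrow> 'a cell"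
    ("_\<^sup>-\<^sup>1\<index>" [1000] 999) where
  "r\<^sup>-\<^sup>1 = (THE r'. inverse_cells C r r')" for C (structure)

definition id_span :: "('o, 'a, 'm) category_scheme \<Rightarrow> 'o \<Rightarrow> 'a span" where
  "id_span C U = Span (Id C U) (Id C U)"

text \<open>Horizontal composites: \<open>T \<odot> S\<close> is first \<open>S\<close>, then \<open>T\<close>, and \<open>pr0 C T S\<close>, \<open>pr1 C T S\<close>
  are the projections of its apex to those of \<open>S\<close> and of \<open>T\<close>, in this order.\<close>

definition pr0 :: "('o, 'a, 'm) pb_category_scheme \<Rightarrow> 'a span \<Rightarrow> 'a span \<Rightarrow> 'a" where
  "pr0 C T S = Proj0 C (leg1 S) (leg0 T)"

definition pr1 :: "('o, 'a, 'm) pb_category_scheme \<Rightarrow> 'a span \<Rightarrow> 'a span \<Rightarrow> 'a" where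
  "pr1 C T S = Proj1 C (leg1 S) (leg0 T)"

definition hcomp :: "('o, 'a, 'm) pb_category_scheme \<Rightarrow> 'a span \<Rightarrow> 'a span \<Rightarrow> 'a span"
    (infixr "\<odot>\<index>" 70) where
  "T \<odot> S = Span (leg0 S \<bullet> pr0 C T S) (leg1 T \<bullet> pr1 C T S)" for C (structure)

text \<open>The arrow into the apex of \<open>T \<odot> S\<close> with components \<open>a\<close> (into \<open>S\<close>) and \<open>b\<close> (into \<open>T\<close>).\<close>

definition lift :: "('o, 'a, 'm) pb_category_scheme \<Rightarrow> 'a span \<Rightarrow> 'a span \<Rightarrow> 'a \<Rightarrow> 'a \<Rightarrow> 'a" where
  "lift C T S a b = (THE h. h \<in> hom C (Dom C a) (apex C (T \<odot> S)) \<and>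
     pr0 C T S \<bullet> h = a \<and> pr1 C T S \<bullet> h = b)" for C (structure)

definition hcomp_cell :: "('o, 'a, 'm) pb_category_scheme \<Rightarrow> 'a cell \<Rightarrow> 'a cell \<Rightarrow> 'a cell" where
  "hcomp_cell C t r = Cell (src t \<odot> src r)
     (lift C (tgt t) (tgt r) (arr r \<bullet> pr0 C (src t) (src r)) (arr t \<bullet> pr1 C (src t) (src r)))
     (tgt t \<odot> tgt r)" for C (structure)

definition whisker_left :: "('o, 'a, 'm) pb_category_scheme \<Rightarrow> 'a span \<Rightarrow> 'a cell \<Rightarrow> 'a cell"
    (infixr "\<rhd>\<index>" 65) where
  "T \<rhd> r = hcomp_cell C (id_cell C T) r" for C (structure)

definition whisker_right :: "('o, 'a, 'm) pb_category_scheme \<Rightarrow> 'a cell \<Rightarrow> 'a span \<Rightarrow> 'a cell"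
    (infixl "\<lhd>\<index>" 65) where
  "t \<lhd> S = hcomp_cell C t (id_cell C S)" for C (structure)

text \<open>Constraints: \<open>\<a> K T S : (K \<odot> T) \<odot> S \<rightarrow> K \<odot> (T \<odot> S)\<close>, \<open>\<l> S : 1 \<odot> S \<rightarrow> S\<close> and
  \<open>\<r> S : S \<odot> 1 \<rightarrow> S\<close>. On generalised elements, \<open>\<a>\<close> sends \<open>(s, (t, k))\<close> to \<open>((s, t), k)\<close>.\<close>

definition assoc ::
    "('o, 'a, 'm) pb_category_scheme \<Rightarrow> 'a span \<Rightarrow> 'a span \<Rightarrow> 'a span \<Rightarrow> 'a cell" ("\<a>\<index>") where
  "\<a> K T S = Cell ((K \<odot> T) \<odot> S)
     (lift C K (T \<odot> S)
        (lift C T S (pr0 C (K \<odot> T) S) (pr0 C K T \<bullet> pr1 C (K \<odot> T) S))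
        (pr1 C K T \<bullet> pr1 C (K \<odot> T) S))
     (K \<odot> (T \<odot> S))" for C (structure)

definition lunit :: "('o, 'a, 'm) pb_category_scheme \<Rightarrow> 'a span \<Rightarrow> 'a cell" ("\<l>\<index>") where
  "\<l> S = (let I = id_span C (Cod C (leg1 S)) in Cell (I \<odot> S) (pr0 C I S) S)" for C (structure)

definition runit :: "('o, 'a, 'm) pb_category_scheme \<Rightarrow> 'a span \<Rightarrow> 'a cell" ("\<r>\<index>") where
  "\<r> S = (let I = id_span C (Cod C (leg0 S)) in Cell (S \<odot> I) (pr1 C S I) S)" for C (structure)

definition lower_star :: "('o, 'a, 'm) category_scheme \<Rightarrow> 'a \<Rightarrow> 'a span"
    ("_\<^sub>\<star>\<index>" [1000] 999) where
  "f\<^sub>\<star> = Span (Id C (Dom C f)) f" for C (structure)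

definition upper_star :: "('o, 'a, 'm) category_scheme \<Rightarrow> 'a \<Rightarrow> 'a span"
    ("_\<^sup>\<star>\<index>" [1000] 999) where
  "f\<^sup>\<star> = Span f (Id C (Dom C f))" for C (structure)

text \<open>The counit of \<open>f\<^sub>\<star> \<stileturn> f\<^sup>\<star>\<close>. A 2-cell from a span \<open>S\<close> to an identity span exists only if the legs
  of \<open>S\<close> agree, and is then given by that leg; so there is exactly one 2-cell
  \<open>f\<^sub>\<star> \<odot> f\<^sup>\<star> \<rightarrow> 1\<close>.\<close>

definition counit_cell :: "('o, 'a, 'm) pb_category_scheme \<Rightarrow> 'a \<Rightarrow> 'a cell" ("\<epsilon>\<index>") where
  "\<epsilon> f = Cell (f\<^sub>\<star> \<odot> f\<^sup>\<star>) (leg0 (f\<^sub>\<star> \<odot> f\<^sup>\<star>)) (id_span C (Cod C f))" for C (structure)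


section \<open>Internal categories, functors and adjunctions\<close>

locale internal_category = category_with_pullbacks C
  for C :: "('o, 'a, 'm) pb_category_scheme" (structure) +
  fixes A :: 'o and S :: "'a span" and \<eta> \<mu> :: "'a cell"
  assumes obj: "A \<in> Obj C"
    and span: "S \<in> spans C A A"
    and unit: "\<eta> \<in> cells C (id_span C A) S"
    and mult: "\<mu> \<in> cells C (S \<odot> S) S"
    and mult_assoc: "\<mu> \<cdot> (\<mu> \<lhd> S) = \<mu> \<cdot> (S \<rhd> \<mu>) \<cdot> \<a> S S S"
    and unit_left: "\<mu> \<cdot> (\<eta> \<lhd> S) = \<l> S"
    and unit_right: "\<mu> \<cdot> (S \<rhd> \<eta>) = \<r> S"

text \<open>The parameters of the domain \<open>(X, T)\<close> precede those of the codomain \<open>(A, S)\<close>.\<close>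

locale internal_functor =
  XT: internal_category C X T \<eta>\<^sub>T \<mu>\<^sub>T + AS: internal_category C A S \<eta>\<^sub>S \<mu>\<^sub>S
  for C :: "('o, 'a, 'm) pb_category_scheme" (structure)
    and X T \<eta>\<^sub>T \<mu>\<^sub>T and A S \<eta>\<^sub>S \<mu>\<^sub>S +
  fixes f :: 'a and \<phi> :: "'a cell"
  assumes arrow: "f \<in> hom C X A"
    and cell: "\<phi> \<in> cells C (f\<^sub>\<star> \<odot> T) (S \<odot> f\<^sub>\<star>)"
    and preserves_mult:
      "(\<mu>\<^sub>S \<lhd> f\<^sub>\<star>) \<cdot> (\<a> S S (f\<^sub>\<star>))\<^sup>-\<^sup>1 \<cdot> (S \<rhd> \<phi>) \<cdot> \<a> S (f\<^sub>\<star>) T \<cdot> (\<phi> \<lhd> T) =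
       \<phi> \<cdot> (f\<^sub>\<star> \<rhd> \<mu>\<^sub>T) \<cdot> \<a> (f\<^sub>\<star>) T T"
    and preserves_unit:
      "\<phi> \<cdot> (f\<^sub>\<star> \<rhd> \<eta>\<^sub>T) \<cdot> (\<r> (f\<^sub>\<star>))\<^sup>-\<^sup>1 = (\<eta>\<^sub>S \<lhd> f\<^sub>\<star>) \<cdot> (\<l> (f\<^sub>\<star>))\<^sup>-\<^sup>1"

text \<open>The adjunction \<open>(f\<^sub>\<star>, \<phi>) \<stileturn> (u\<^sub>\<star>, \<upsilon>) : (A, S) \<rightarrow> (X, T)\<close> with counit \<open>\<alpha>\<close> and unit \<open>\<beta>\<close>:
  the first two equations express naturality of \<open>\<alpha>\<close> and of \<open>\<beta>\<close>, the others are the triangle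
  identities. The middle composite \<open>T u f\<close> is bracketed as \<open>T \<odot> (u\<^sub>\<star> \<odot> f\<^sub>\<star>)\<close>.\<close>

locale internal_adjunction =
  F: internal_functor C X T \<eta>\<^sub>T \<mu>\<^sub>T A S \<eta>\<^sub>S \<mu>\<^sub>S f \<phi> +
  U: internal_functor C A S \<eta>\<^sub>S \<mu>\<^sub>S X T \<eta>\<^sub>T \<mu>\<^sub>T u \<upsilon>
  for C :: "('o, 'a, 'm) pb_category_scheme" (structure)
    and X T \<eta>\<^sub>T \<mu>\<^sub>T and A S \<eta>\<^sub>S \<mu>\<^sub>S and f \<phi> and u \<upsilon> +
  fixes \<alpha> \<beta> :: "'a cell"
  assumes counit_cell: "\<alpha> \<in> cells C (f\<^sub>\<star> \<odot> u\<^sub>\<star>) S"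
    and unit_cell: "\<beta> \<in> cells C (id_span C X) (T \<odot> (u\<^sub>\<star> \<odot> f\<^sub>\<star>))"
    and counit_natural:
      "\<mu>\<^sub>S \<cdot> (\<alpha> \<lhd> S) =
       \<mu>\<^sub>S \<cdot> (S \<rhd> \<alpha>) \<cdot> \<a> S (f\<^sub>\<star>) (u\<^sub>\<star>) \<cdot> (\<phi> \<lhd> u\<^sub>\<star>) \<cdot> (\<a> (f\<^sub>\<star>) T (u\<^sub>\<star>))\<^sup>-\<^sup>1
         \<cdot> (f\<^sub>\<star> \<rhd> \<upsilon>) \<cdot> \<a> (f\<^sub>\<star>) (u\<^sub>\<star>) S"
    and unit_natural:
      "(\<mu>\<^sub>T \<lhd> (u\<^sub>\<star> \<odot> f\<^sub>\<star>)) \<cdot> (\<a> T T (u\<^sub>\<star> \<odot> f\<^sub>\<star>))\<^sup>-\<^sup>1 \<cdot> (T \<rhd> \<beta>) \<cdot> (\<r> T)\<^sup>-\<^sup>1 =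
       (\<mu>\<^sub>T \<lhd> (u\<^sub>\<star> \<odot> f\<^sub>\<star>)) \<cdot> (\<a> T T (u\<^sub>\<star> \<odot> f\<^sub>\<star>))\<^sup>-\<^sup>1
         \<cdot> (T \<rhd> (\<a> T (u\<^sub>\<star>) (f\<^sub>\<star>) \<cdot> (\<upsilon> \<lhd> f\<^sub>\<star>)))
         \<cdot> (T \<rhd> ((\<a> (u\<^sub>\<star>) S (f\<^sub>\<star>))\<^sup>-\<^sup>1 \<cdot> (u\<^sub>\<star> \<rhd> \<phi>) \<cdot> \<a> (u\<^sub>\<star>) (f\<^sub>\<star>) T))
         \<cdot> \<a> T (u\<^sub>\<star> \<odot> f\<^sub>\<star>) T \<cdot> (\<beta> \<lhd> T) \<cdot> (\<l> T)\<^sup>-\<^sup>1"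
    and triangle_left:
      "(\<eta>\<^sub>S \<lhd> f\<^sub>\<star>) \<cdot> (\<l> (f\<^sub>\<star>))\<^sup>-\<^sup>1 =
       (\<mu>\<^sub>S \<lhd> f\<^sub>\<star>) \<cdot> (\<a> S S (f\<^sub>\<star>))\<^sup>-\<^sup>1
         \<cdot> (S \<rhd> ((\<alpha> \<lhd> f\<^sub>\<star>) \<cdot> (\<a> (f\<^sub>\<star>) (u\<^sub>\<star>) (f\<^sub>\<star>))\<^sup>-\<^sup>1))
         \<cdot> \<a> S (f\<^sub>\<star>) (u\<^sub>\<star> \<odot> f\<^sub>\<star>) \<cdot> (\<phi> \<lhd> (u\<^sub>\<star> \<odot> f\<^sub>\<star>)) \<cdot> (\<a> (f\<^sub>\<star>) T (u\<^sub>\<star> \<odot> f\<^sub>\<star>))\<^sup>-\<^sup>1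
         \<cdot> (f\<^sub>\<star> \<rhd> \<beta>) \<cdot> (\<r> (f\<^sub>\<star>))\<^sup>-\<^sup>1"
    and triangle_right:
      "(\<eta>\<^sub>T \<lhd> u\<^sub>\<star>) \<cdot> (\<l> (u\<^sub>\<star>))\<^sup>-\<^sup>1 =
       (\<mu>\<^sub>T \<lhd> u\<^sub>\<star>) \<cdot> (\<a> T T (u\<^sub>\<star>))\<^sup>-\<^sup>1 \<cdot> (T \<rhd> \<upsilon>)
         \<cdot> (T \<rhd> ((u\<^sub>\<star> \<rhd> \<alpha>) \<cdot> \<a> (u\<^sub>\<star>) (f\<^sub>\<star>) (u\<^sub>\<star>)))
         \<cdot> \<a> T (u\<^sub>\<star> \<odot> f\<^sub>\<star>) (u\<^sub>\<star>) \<cdot> (\<beta> \<lhd> u\<^sub>\<star>) \<cdot> (\<l> (u\<^sub>\<star>))\<^sup>-\<^sup>1"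

text \<open>The cell \<open>\<pi>\<close> of the core \<open>(u\<^sub>\<star>, f\<^sup>\<star>, \<pi>)\<close> associated with an adjunction, that is
  \<open>\<mu> u \<cdot> T \<upsilon> \<cdot> T u \<epsilon> S \<cdot> \<beta> f\<^sup>\<star> S\<close> with the constraints inserted.\<close>

definition associated_core :: "('o, 'a, 'm) pb_category_scheme \<Rightarrow>
    'a span \<Rightarrow> 'a cell \<Rightarrow> 'a span \<Rightarrow> 'a \<Rightarrow> 'a \<Rightarrow> 'a cell \<Rightarrow> 'a cell \<Rightarrow> 'a cell" where
  "associated_core C T \<mu>\<^sub>T S f u \<upsilon> \<beta> =
     (\<mu>\<^sub>T \<lhd> u\<^sub>\<star>) \<cdot> (\<a> T T (u\<^sub>\<star>))\<^sup>-\<^sup>1 \<cdot> (T \<rhd> \<upsilon>)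
       \<cdot> (T \<rhd> (u\<^sub>\<star> \<rhd> (\<l> S \<cdot> (\<epsilon> f \<lhd> S) \<cdot> (\<a> (f\<^sub>\<star>) (f\<^sup>\<star>) S)\<^sup>-\<^sup>1)))
       \<cdot> (T \<rhd> \<a> (u\<^sub>\<star>) (f\<^sub>\<star>) (f\<^sup>\<star> \<odot> S)) \<cdot> \<a> T (u\<^sub>\<star> \<odot> f\<^sub>\<star>) (f\<^sup>\<star> \<odot> S)
       \<cdot> (\<beta> \<lhd> (f\<^sup>\<star> \<odot> S)) \<cdot> (\<l> (f\<^sup>\<star> \<odot> S))\<^sup>-\<^sup>1" for C (structure)

definition core_extends_to :: "('o, 'a, 'm) pb_category_scheme \<Rightarrow>
    'o \<Rightarrow> 'a span \<Rightarrow> 'a cell \<Rightarrow> 'a cell \<Rightarrow> 'o \<Rightarrow> 'a span \<Rightarrow> 'a cell \<Rightarrow> 'a cell \<Rightarrow>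
    'a \<Rightarrow> 'a \<Rightarrow> 'a cell \<Rightarrow> 'a cell \<Rightarrow> 'a cell \<Rightarrow> 'a cell \<Rightarrow> 'a cell \<Rightarrow> bool" where
  "core_extends_to C X T \<eta>\<^sub>T \<mu>\<^sub>T A S \<eta>\<^sub>S \<mu>\<^sub>S f u \<pi> \<phi> \<upsilon> \<alpha> \<beta> \<longleftrightarrow>
     internal_adjunction C X T \<eta>\<^sub>T \<mu>\<^sub>T A S \<eta>\<^sub>S \<mu>\<^sub>S f \<phi> u \<upsilon> \<alpha> \<beta> \<and>
     associated_core C T \<mu>\<^sub>T S f u \<upsilon> \<beta> = \<pi>"

end

theory Submission
  imports Defs
begin

text \<open>Everything is computed on generalised elements. An element \<open>h : W \<rightarrow> S\<close> of the apex of a span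
  \<open>S : A \<rightarrow> A\<close> with legs \<open>x = s\<^sub>0 h\<close>, \<open>y = s\<^sub>1 h\<close> is regarded as an arrow \<open>y \<rightarrow> x\<close> between the points
  \<open>y, x : W \<rightarrow> A\<close>. Elements of \<open>T \<odot> S\<close> are composable pairs, so a category in \<open>C\<close> gives an ordinary
  category at each stage \<open>W\<close>, and by the Yoneda argument two 2-cells are equal as soon as they agree
  on all elements (\<open>cells_eqI\<close>). The constraints of \<open>Span(C)\<close> merely rebracket pairs or delete and
  insert identities. Hence every pasting of 2-cells in the statement can be evaluated
  mechanically, and each equation between pastings becomes a familiar equation between arrows.

  In these terms \<open>f\<^sup>\<star> \<odot> S\<close> consists of arrows \<open>f x \<rightarrow> a\<close> of \<open>S\<close>, \<open>T \<odot> u\<^sub>\<star>\<close> consists of arrows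
  \<open>x \<rightarrow> u a\<close> of \<open>T\<close>, and \<open>\<pi>\<close> is a transposition bijection \<open>A(f x, a) \<cong> X(x, u a)\<close> without any naturality
  in \<open>x\<close> or \<open>a\<close>. It yields candidates for the remaining data by the usual formulas: the unit at \<open>x\<close> is
  \<open>\<pi>(1)\<close>, the counit at \<open>a\<close> is \<open>\<pi>\<^sup>-\<^sup>1(1)\<close>, on arrows \<open>u s = \<pi>(s \<cdot> counit)\<close> and \<open>f t = \<pi>\<^sup>-\<^sup>1(unit \<cdot> t)\<close>.
  Condition (I) reads \<open>u s \<cdot> \<pi>(s') = \<pi>(s s')\<close>, naturality of \<open>\<pi>\<close> in \<open>a\<close>, and condition (II) reads
  \<open>\<pi>\<^sup>-\<^sup>1(t) \<cdot> f t' = \<pi>\<^sup>-\<^sup>1(t t')\<close>, naturality in \<open>x\<close>.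

  The argument at a fixed stage is then that of ordinary category theory. Condition (II) implies
  condition (I) (\<open>left_compatible_imp_right_compatible\<close>), because the counit recovers
  \<open>\<pi>\<^sup>-\<^sup>1\<close> from \<open>f\<close>. Condition (I) makes \<open>u\<close> a functor and each unit component a universal arrow, that
  is \<open>\<pi>(s) = u s \<cdot> unit\<close>; functoriality of \<open>f\<close>, naturality and the triangle identities follow by
  comparing transposes (\<open>right_compatible_imp_adjunction\<close>). Conversely an adjunction with core \<open>\<pi>\<close>
  satisfies \<open>\<pi>(s) = u s \<cdot> unit\<close>, which forces both condition (I) and the above formulas for all its
  data, whence uniqueness (\<open>extension_determined\<close>).\<close>

section \<open>Generalised elements of spans\<close>

text \<open>The stage of definition of an element \<open>h\<close> is its domain. Recording the legs \<open>x\<close> and \<open>y\<close> makes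
  composability of two elements a matter of matching arguments.\<close>

definition element :: "('o, 'a, 'm) category_scheme \<Rightarrow> 'a span \<Rightarrow> 'a \<Rightarrow> 'a \<Rightarrow> 'a \<Rightarrow> bool" where
  "element C S x y h \<longleftrightarrow> S \<in> spans C (Cod C x) (Cod C y) \<and> h \<in> hom C (Dom C h) (apex C S) \<and>
     leg0 S \<bullet> h = x \<and> leg1 S \<bullet> h = y" for C (structure)

text \<open>The graph of a 2-cell on elements. Carrying the boundary spans and the legs along lets the
  value of a pasting be found by resolution with one rule per constructor.\<close>

definition sends :: "('o, 'a, 'm) category_scheme \<Rightarrow> 'a cell \<Rightarrow> 'a span \<Rightarrow> 'a span \<Rightarrow>
    'a \<Rightarrow> 'a \<Rightarrow> 'a \<Rightarrow> 'a \<Rightarrow> bool" where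
  "sends C r S T x y h k \<longleftrightarrow> r \<in> cells C S T \<and> element C S x y h \<and>
     element C T x y k \<and> arr r \<bullet> h = k" for C (structure)

definition point :: "('o, 'a, 'm) category_scheme \<Rightarrow> 'o \<Rightarrow> 'a \<Rightarrow> bool" where
  "point C U x \<longleftrightarrow> x \<in> hom C (Dom C x) U"

context category
begin

lemma homD: "f \<in> hom C U V \<Longrightarrow> Dom C f = U" "f \<in> hom C U V \<Longrightarrow> Cod C f = V"
    "f \<in> hom C U V \<Longrightarrow> f \<in> Arr C" "f \<in> hom C U V \<Longrightarrow> U \<in> Obj C" "f \<in> hom C U V \<Longrightarrow> V \<in> Obj C"
  using Dom_in_Obj Cod_in_Obj by (auto simp: hom_def)

lemma spansD: "S \<in> spans C U V \<Longrightarrow> leg0 S \<in> hom C (apex C S) U"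
    "S \<in> spans C U V \<Longrightarrow> leg1 S \<in> hom C (apex C S) V"
  by (simp_all add: spans_def)

lemma elementI:
  assumes "S \<in> spans C U V" "h \<in> hom C W (apex C S)" "leg0 S \<bullet> h = x" "leg1 S \<bullet> h = y"
  shows "element C S x y h"
proof -
  have "x \<in> hom C W U" "y \<in> hom C W V"
    using assms spansD Comp_in_hom by blast+
  then show ?thesis using assms homD unfolding element_def by metis
qed

lemma elementD:
  assumes "element C S x y h"
  shows "h \<in> hom C (Dom C h) (apex C S)" "leg0 S \<bullet> h = x" "leg1 S \<bullet> h = y"
    "x \<in> hom C (Dom C h) (Cod C x)" "y \<in> hom C (Dom C h) (Cod C y)"
    "S \<in> spans C (Cod C x) (Cod C y)"
  using assms spansD Comp_in_hom unfolding element_def by (metis)+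

lemma element_spans:
  assumes "element C S x y h" "S \<in> spans C U V"
  shows "x \<in> hom C (Dom C h) U" "y \<in> hom C (Dom C h) V"
  using elementD[OF assms(1)] spansD[OF assms(2)] Comp_in_hom by metis+

lemma element_points:
  assumes "element C S x y h" "S \<in> spans C U V"
  shows "point C U x" "point C V y"
  using element_spans[OF assms] homD unfolding point_def by metis+

text \<open>Yoneda's lemma: the identity of the apex is the universal element.\<close>

lemma element_generic:
  assumes "S \<in> spans C U V"
  shows "element C S (leg0 S) (leg1 S) (Id C (apex C S))"
  using assms by (intro elementI) (auto intro!: Comp_Id Id_in_hom dest: spansD homD)

lemma cellsD:
  assumes "r \<in> cells C S T"
  shows "src r = S" "tgt r = T" "arr r \<in> hom C (apex C S) (apex C T)"
    "leg0 T \<bullet> arr r = leg0 S" "leg1 T \<bullet> arr r = leg1 S"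
  using assms by (auto simp: cells_def)

lemma sends_cell:
  assumes "r \<in> cells C S T" "T \<in> spans C U V" "element C S x y h"
  shows "sends C r S T x y h (arr r \<bullet> h)"
proof -
  note r = cellsD[OF assms(1)] and h = elementD[OF assms(3)]
  have k: "arr r \<bullet> h \<in> hom C (Dom C h) (apex C T)"
    using r h Comp_in_hom by blast
  have "leg0 T \<bullet> (arr r \<bullet> h) = x" "leg1 T \<bullet> (arr r \<bullet> h) = y"
    using r h Comp_assoc spansD[OF assms(2)] by metis+
  then show ?thesis using elementI[OF assms(2) k] assms r by (auto simp: sends_def)
qed

lemma sendsD:
  assumes "sends C r S T x y h k"
  shows "r \<in> cells C S T" "element C S x y h" "element C T x y k" "arr r \<bullet> h = k"
  using assms by (auto simp: sends_def)

lemma sends_unique: "sends C r S T x y h k \<Longrightarrow> sends C r S' T' x' y' h k' \<Longrightarrow> k = k'"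
  by (simp add: sends_def)

lemma cells_eqI:
  assumes "S \<in> spans C U V"
    and "\<And>x y h. element C S x y h \<Longrightarrow> \<exists>k. sends C r S T x y h k \<and> sends C r' S T x y h k"
  shows "r = r'"
proof -
  obtain k where k: "sends C r S T (leg0 S) (leg1 S) (Id C (apex C S)) k"
      "sends C r' S T (leg0 S) (leg1 S) (Id C (apex C S)) k"
    using assms(2) element_generic[OF assms(1)] by blast
  have "arr r = k" "arr r' = k"
    using k[THEN sendsD(4)] k[THEN sendsD(1), THEN cellsD(3)] Comp_Id by metis+
  moreover have "src r = S" "tgt r = T" "src r' = S" "tgt r' = T"
    using k[THEN sendsD(1)] cellsD(1,2) by blast+
  ultimately show ?thesis by (cases r; cases r') auto
qed

text \<open>The converse use of the universal element: an element of \<open>T\<close> at the stage of the apex of \<open>S\<close>,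
  with the legs of \<open>S\<close>, is the same thing as a 2-cell from \<open>S\<close> to \<open>T\<close>.\<close>

lemma generic_cell: "element C T (leg0 S) (leg1 S) h \<Longrightarrow> S \<in> spans C U V \<Longrightarrow> Dom C h = apex C S \<Longrightarrow>
    Cell S h T \<in> cells C S T"
  using elementD[of T "leg0 S" "leg1 S" h] by (auto simp: cells_def)

lemma element_dom_generic:
  assumes "element C T (leg0 S) y h" "S \<in> spans C U V"
  shows "Dom C h = apex C S"
  using elementD(4)[OF assms(1)] spansD(1)[OF assms(2)] homD by metis

lemma sends_vcomp:
  assumes "sends C r S T x y h k" "sends C r' T K x y k l"
  shows "sends C (r' \<cdot> r) S K x y h l"
proof -
  note r = sendsD[OF assms(1)] and r' = sendsD[OF assms(2)]
  note c = cellsD[OF r(1)] and c' = cellsD[OF r'(1)]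
  have "leg0 K \<bullet> (arr r' \<bullet> arr r) = leg0 S" "leg1 K \<bullet> (arr r' \<bullet> arr r) = leg1 S"
    using c c' Comp_assoc spansD[OF elementD(6)[OF r'(3)]] by metis+
  moreover have "(arr r' \<bullet> arr r) \<bullet> h = l"
    using c c' elementD(1)[OF r(2)] Comp_assoc r(4) r'(4) by metis
  moreover have "arr r' \<bullet> arr r \<in> hom C (apex C S) (apex C K)"
    using c(3) c'(3) Comp_in_hom by blast
  ultimately show ?thesis using r r' c c' by (auto simp: sends_def vcomp_def cells_def)
qed

lemma sends_id:
  assumes "element C S x y h"
  shows "sends C (id_cell C S) S S x y h h"
proof -
  note h = elementD[OF assms]
  have "id_cell C S \<in> cells C S S"
    using spansD[OF h(6)] Comp_Id Id_in_hom[OF homD(5)[OF h(1)]] by (simp add: id_cell_def cells_def)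
  then show ?thesis using assms Id_Comp[OF h(1)] by (simp add: sends_def id_cell_def)
qed

lemma inverse_cellsI:
  assumes "S \<in> spans C U V" "T \<in> spans C U V"
    and "\<And>x y h. element C S x y h \<Longrightarrow> \<exists>k. sends C r S T x y h k \<and> sends C r' T S x y k h"
    and "\<And>x y k. element C T x y k \<Longrightarrow> \<exists>h. sends C r S T x y h k \<and> sends C r' T S x y k h"
  shows "inverse_cells C r r'"
proof -
  have c: "r \<in> cells C S T" "r' \<in> cells C T S"
    using assms(3)[OF element_generic[OF assms(1)]] sendsD(1) by blast+
  have "r' \<cdot> r = id_cell C S"
    using cells_eqI[OF assms(1)] sends_vcomp sends_id assms(3) by meson
  moreover have "r \<cdot> r' = id_cell C T"
    using cells_eqI[OF assms(2)] sends_vcomp sends_id assms(4) by meson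
  ultimately show ?thesis using c cellsD(1,2) unfolding inverse_cells_def by metis
qed

text \<open>Two-sided inverses are unique, so the description in \<open>inv_cell\<close> denotes any inverse that
  one can exhibit.\<close>

lemma inv_cell_eq:
  assumes "inverse_cells C r r'" shows "r\<^sup>-\<^sup>1 = r'"
proof -
  have "r'' = r'" if "inverse_cells C r r''" for r''
  proof -
    let ?S = "src r" and ?T = "tgt r"
    have c: "r \<in> cells C ?S ?T" "r' \<in> cells C ?T ?S" "r'' \<in> cells C ?T ?S"
      and e: "r' \<cdot> r = id_cell C ?S" "r \<cdot> r'' = id_cell C ?T"
      using assms that by (auto simp: inverse_cells_def)
    have "arr r'' = (arr r' \<bullet> arr r) \<bullet> arr r''"
      using e(1) cellsD(3)[OF c(3)] Id_Comp by (auto simp: vcomp_def id_cell_def)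
    also have "\<dots> = arr r' \<bullet> (arr r \<bullet> arr r'')"
      using c[THEN cellsD(3)] Comp_assoc by blast
    also have "\<dots> = arr r'"
      using e(2) cellsD(3)[OF c(2)] Comp_Id by (auto simp: vcomp_def id_cell_def)
    finally show ?thesis using c(2,3)[THEN cellsD(1)] c(2,3)[THEN cellsD(2)] by (cases r'; cases r'') auto
  qed
  with assms show ?thesis unfolding inv_cell_def by (rule the_equality)
qed

lemma sends_inverse:
  assumes "inverse_cells C r r'" "sends C r S T x y h k"
  shows "sends C r' T S x y k h"
proof -
  note r = sendsD[OF assms(2)] and c = cellsD[OF sendsD(1)[OF assms(2)]]
  have c': "r' \<in> cells C T S" and e: "arr r' \<bullet> arr r = Id C (apex C S)"
    using assms(1) c by (auto simp: inverse_cells_def vcomp_def id_cell_def)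
  have "arr r' \<bullet> k = h"
    using r c cellsD[OF c'] e elementD(1)[OF r(2)] Comp_assoc Id_Comp by metis
  then show ?thesis using c' r by (simp add: sends_def)
qed

end

section \<open>Elements of horizontal composites\<close>

lemma (in category_with_pullbacks) is_pullback_pr:
  assumes "S \<in> spans C U V" "T \<in> spans C V Z"
  shows "is_pullback C (leg1 S) (leg0 T) (pr0 C T S) (pr1 C T S)"
  using pullback homD(2,3) spansD assms unfolding pr0_def pr1_def by metis

context category_with_pullbacks
begin

lemma pr_in_hom:
  assumes "S \<in> spans C U V" "T \<in> spans C V Z"
  shows "pr0 C T S \<in> hom C (apex C (T \<odot> S)) (apex C S)"
    "pr1 C T S \<in> hom C (apex C (T \<odot> S)) (apex C T)"
    "leg1 S \<bullet> pr0 C T S = leg0 T \<bullet> pr1 C T S"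
proof -
  have *: "pr0 C T S \<in> hom C (Dom C (pr0 C T S)) (apex C S)"
    "pr1 C T S \<in> hom C (Dom C (pr0 C T S)) (apex C T)"
    "leg1 S \<bullet> pr0 C T S = leg0 T \<bullet> pr1 C T S"
    using is_pullback_pr[OF assms] homD(1) spansD assms unfolding is_pullback_def by metis+
  moreover have "apex C (T \<odot> S) = Dom C (pr0 C T S)"
    unfolding apex_def hcomp_def using *(1) spansD(1)[OF assms(1)] Comp_in_hom homD(1) by (metis span.sel(1))
  ultimately show "pr0 C T S \<in> hom C (apex C (T \<odot> S)) (apex C S)"
    "pr1 C T S \<in> hom C (apex C (T \<odot> S)) (apex C T)"
    "leg1 S \<bullet> pr0 C T S = leg0 T \<bullet> pr1 C T S" by simp_all
qed

lemma hcomp_in_spans: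
  assumes "S \<in> spans C U V" "T \<in> spans C V Z"
  shows "T \<odot> S \<in> spans C U Z"
  using pr_in_hom[OF assms] spansD[OF assms(1)] spansD[OF assms(2)] Comp_in_hom
  unfolding spans_def hcomp_def by simp

lemma element_pr:
  assumes "S \<in> spans C U V" "T \<in> spans C V Z"
  shows "element C S (leg0 (T \<odot> S)) (leg1 S \<bullet> pr0 C T S) (pr0 C T S)"
    "element C T (leg1 S \<bullet> pr0 C T S) (leg1 (T \<odot> S)) (pr1 C T S)"
  using pr_in_hom[OF assms] assms by (auto intro!: elementI simp: hcomp_def)

lemma hcomp_legs:
  assumes "S \<in> spans C U V" "T \<in> spans C V Z" "h \<in> hom C W (apex C (T \<odot> S))"
  shows "leg0 (T \<odot> S) \<bullet> h = leg0 S \<bullet> (pr0 C T S \<bullet> h)"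
    "leg1 (T \<odot> S) \<bullet> h = leg1 T \<bullet> (pr1 C T S \<bullet> h)"
    "leg1 S \<bullet> (pr0 C T S \<bullet> h) = leg0 T \<bullet> (pr1 C T S \<bullet> h)"
proof -
  note p = pr_in_hom[OF assms(1,2)]
  note assoc0 = Comp_assoc[OF assms(3) p(1)] and assoc1 = Comp_assoc[OF assms(3) p(2)]
  show "leg0 (T \<odot> S) \<bullet> h = leg0 S \<bullet> (pr0 C T S \<bullet> h)"
    using assoc0[OF spansD(1)[OF assms(1)]] by (simp add: hcomp_def)
  show "leg1 (T \<odot> S) \<bullet> h = leg1 T \<bullet> (pr1 C T S \<bullet> h)"
    using assoc1[OF spansD(2)[OF assms(2)]] by (simp add: hcomp_def)
  show "leg1 S \<bullet> (pr0 C T S \<bullet> h) = leg0 T \<bullet> (pr1 C T S \<bullet> h)"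
    using assoc0[OF spansD(2)[OF assms(1)]] assoc1[OF spansD(1)[OF assms(2)]] p(3) by simp
qed

text \<open>The universal property of the chosen pullback, in terms of elements: \<open>lift C T S a b\<close> is the pair
  of composable elements \<open>a\<close> of \<open>S\<close> and \<open>b\<close> of \<open>T\<close>.\<close>

lemma lift_props:
  assumes "element C S x y a" "element C T y z b"
  shows "element C (T \<odot> S) x z (lift C T S a b)"
    "pr0 C T S \<bullet> lift C T S a b = a" "pr1 C T S \<bullet> lift C T S a b = b"
    "\<And>h. h \<in> hom C (Dom C a) (apex C (T \<odot> S)) \<Longrightarrow> pr0 C T S \<bullet> h = a \<Longrightarrow> pr1 C T S \<bullet> h = b
      \<Longrightarrow> h = lift C T S a b"
proof -
  note a = elementD[OF assms(1)] and b = elementD[OF assms(2)]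
  note S = a(6) and T = b(6)
  have "Dom C b = Dom C a" using a(5) b(4) homD(1) by metis
  then have "\<exists>!h. h \<in> hom C (Dom C a) (apex C (T \<odot> S)) \<and> pr0 C T S \<bullet> h = a \<and> pr1 C T S \<bullet> h = b"
    using is_pullback_pr[OF S T] pr_in_hom(1)[OF S T, THEN homD(1)] a b
      spansD[OF S, THEN homD(1)] spansD[OF T, THEN homD(1)] homD(4)[OF a(1)]
    unfolding is_pullback_def by metis
  note ex = theI'[OF this, folded lift_def] the1_equality[OF this, folded lift_def]
  then show 1: "pr0 C T S \<bullet> lift C T S a b = a" "pr1 C T S \<bullet> lift C T S a b = b"
    "\<And>h. h \<in> hom C (Dom C a) (apex C (T \<odot> S)) \<Longrightarrow> pr0 C T S \<bullet> h = a \<Longrightarrow> pr1 C T S \<bullet> h = b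
      \<Longrightarrow> h = lift C T S a b" by metis+
  show "element C (T \<odot> S) x z (lift C T S a b)"
  proof (rule elementI[OF hcomp_in_spans[OF S T]])
    show h: "lift C T S a b \<in> hom C (Dom C a) (apex C (T \<odot> S))" using ex by blast
    show "leg0 (T \<odot> S) \<bullet> lift C T S a b = x" "leg1 (T \<odot> S) \<bullet> lift C T S a b = z"
      using hcomp_legs[OF S T h] 1(1,2) a(2) b(3) by simp_all
  qed
qed

lemmas lift_element = lift_props(1) and pr0_lift = lift_props(2) and pr1_lift = lift_props(3)

text \<open>Every element of a composite is a pair, so it suffices to evaluate 2-cells on pairs.\<close>

lemma element_hcompE:
  assumes "element C (T \<odot> S) x z h" "S \<in> spans C U V" "T \<in> spans C V Z"
  obtains y a b where "element C S x y a" "element C T y z b" "h = lift C T S a b"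
    "a = pr0 C T S \<bullet> h" "b = pr1 C T S \<bullet> h"
proof -
  note h = elementD[OF assms(1)] and p = pr_in_hom[OF assms(2,3)]
  define a b where ab: "a = pr0 C T S \<bullet> h" "b = pr1 C T S \<bullet> h"
  have d: "a \<in> hom C (Dom C h) (apex C S)" "b \<in> hom C (Dom C h) (apex C T)"
    using ab p h Comp_in_hom by blast+
  have l: "leg0 S \<bullet> a = x" "leg1 S \<bullet> a = leg0 T \<bullet> b" "leg1 T \<bullet> b = z"
    using hcomp_legs[OF assms(2,3) h(1)] h(2,3) ab by simp_all
  have e: "element C S x (leg0 T \<bullet> b) a" "element C T (leg0 T \<bullet> b) z b"
    using elementI[OF assms(2) d(1)] elementI[OF assms(3) d(2)] l by auto
  moreover have "h = lift C T S a b"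
    by (rule lift_props(4)[OF e _ ab(1)[symmetric] ab(2)[symmetric]]) (use h(1) d(1)[THEN homD(1)] in simp)
  ultimately show thesis using that ab by blast
qed

lemma element_comp:
  assumes "element C S x y a" "k \<in> hom C (Dom C k) (Dom C a)"
  shows "element C S (x \<bullet> k) (y \<bullet> k) (a \<bullet> k)"
proof -
  note a = elementD[OF assms(1)]
  show ?thesis
    using Comp_assoc[OF assms(2) a(1)] spansD[OF a(6)] a(2,3)
    by (intro elementI[OF a(6) Comp_in_hom[OF assms(2) a(1)]]) auto
qed

lemma element_Dom:
  assumes "element C S x y a" "element C T y z b"
  shows "Dom C b = Dom C a"
  using elementD(5)[OF assms(1)] elementD(4)[OF assms(2)] homD(1) by metis

lemma lift_in_hom:
  assumes "element C S x y a" "element C T y z b"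
  shows "lift C T S a b \<in> hom C (Dom C a) (apex C (T \<odot> S))"
proof -
  note l = lift_element[OF assms]
  have "Dom C (lift C T S a b) = Dom C a"
    using elementD(4)[OF l] elementD(4)[OF assms(1)] homD(1) by metis
  then show ?thesis using elementD(1)[OF l] by simp
qed

text \<open>Pairing is natural in the stage. This reduces the value of a 2-cell defined by pairing to the
  values of its components.\<close>

lemma lift_comp:
  assumes "element C S x y a" "element C T y z b" "k \<in> hom C (Dom C k) (Dom C a)"
  shows "lift C T S a b \<bullet> k = lift C T S (a \<bullet> k) (b \<bullet> k)"
proof -
  note S = elementD(6)[OF assms(1)] and T = elementD(6)[OF assms(2)]
  note l = lift_in_hom[OF assms(1,2)]
  have k: "k \<in> hom C (Dom C k) (Dom C b)"
    using assms(3) element_Dom[OF assms(1,2)] by simp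
  note e = element_comp[OF assms(1,3)] element_comp[OF assms(2) k]
  have d: "Dom C (a \<bullet> k) = Dom C k"
    using Comp_in_hom[OF assms(3) elementD(1)[OF assms(1)]] homD(1) by blast
  show ?thesis
  proof (rule lift_props(4)[OF e])
    show "lift C T S a b \<bullet> k \<in> hom C (Dom C (a \<bullet> k)) (apex C (T \<odot> S))"
      unfolding d by (rule Comp_in_hom[OF assms(3) l])
    show "pr0 C T S \<bullet> (lift C T S a b \<bullet> k) = a \<bullet> k" "pr1 C T S \<bullet> (lift C T S a b \<bullet> k) = b \<bullet> k"
      using Comp_assoc[OF assms(3) l] pr_in_hom[OF S T] pr0_lift[OF assms(1,2)] pr1_lift[OF assms(1,2)]
      by metis+
  qed
qed

section \<open>Action of the constraints on elements\<close>

lemma sends_hcomp: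
  assumes "sends C r S S' x y a a'" "sends C t T T' y z b b'"
  shows "sends C (hcomp_cell C t r) (T \<odot> S) (T' \<odot> S') x z (lift C T S a b) (lift C T' S' a' b')"
proof -
  note r = sendsD[OF assms(1)] and t = sendsD[OF assms(2)]
  note S = elementD(6)[OF r(2)] and T = elementD(6)[OF t(2)]
  note S' = elementD(6)[OF r(3)] and T' = elementD(6)[OF t(3)]
  note cr = cellsD[OF r(1)] and ct = cellsD[OF t(1)]
  note p = element_pr[OF S T]
  let ?a = "arr r \<bullet> pr0 C T S" and ?b = "arr t \<bullet> pr1 C T S"
  have e: "element C S' (leg0 (T \<odot> S)) (leg1 S \<bullet> pr0 C T S) ?a"
       "element C T' (leg1 S \<bullet> pr0 C T S) (leg1 (T \<odot> S)) ?b"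
    using sends_cell[OF r(1) S' p(1)] sends_cell[OF t(1) T' p(2)] sendsD(3) by blast+
  have arr: "arr (hcomp_cell C t r) = lift C T' S' ?a ?b"
    using cr ct by (simp add: hcomp_cell_def)
  have c: "hcomp_cell C t r \<in> cells C (T \<odot> S) (T' \<odot> S')"
    using generic_cell[OF lift_element[OF e] hcomp_in_spans[OF S T]
        element_dom_generic[OF lift_element[OF e] hcomp_in_spans[OF S T]]] cr ct
    by (simp add: hcomp_cell_def)
  note l = lift_element[OF r(2) t(2)]
  have da: "Dom C ?a = apex C (T \<odot> S)"
    using Comp_in_hom[OF pr_in_hom(1)[OF S T] cr(3)] homD(1) by blast
  have lh: "lift C T S a b \<in> hom C (Dom C (lift C T S a b)) (Dom C ?a)"
    unfolding da by (rule elementD(1)[OF l])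
  have "?a \<bullet> lift C T S a b = a'"
    using Comp_assoc[OF elementD(1)[OF l] pr_in_hom(1)[OF S T] cr(3)] pr0_lift[OF r(2) t(2)] r(4) by simp
  moreover have "?b \<bullet> lift C T S a b = b'"
    using Comp_assoc[OF elementD(1)[OF l] pr_in_hom(2)[OF S T] ct(3)] pr1_lift[OF r(2) t(2)] t(4) by simp
  ultimately have "arr (hcomp_cell C t r) \<bullet> lift C T S a b = lift C T' S' a' b'"
    using lift_comp[OF e lh] arr by simp
  then show ?thesis
    using c l lift_element[OF r(3) t(3)] by (simp add: sends_def)
qed

lemma sends_whisker_left:
  "sends C r S S' x y a a' \<Longrightarrow> element C T y z b \<Longrightarrow>
    sends C (T \<rhd> r) (T \<odot> S) (T \<odot> S') x z (lift C T S a b) (lift C T S' a' b)"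
  unfolding whisker_left_def by (intro sends_hcomp sends_id)

lemma sends_whisker_right:
  "element C S x y a \<Longrightarrow> sends C t T T' y z b b' \<Longrightarrow>
    sends C (t \<lhd> S) (T \<odot> S) (T' \<odot> S) x z (lift C T S a b) (lift C T' S a b')"
  unfolding whisker_right_def by (intro sends_hcomp sends_id)

lemma sends_generic:
  assumes "element C T (leg0 S) (leg1 S) g" "S \<in> spans C U V" "element C S x y h"
  shows "sends C (Cell S g T) S T x y h (g \<bullet> h)"
proof -
  note d = element_dom_generic[OF assms(1,2)]
  show ?thesis
    using sends_cell[OF generic_cell[OF assms(1,2) d] elementD(6)[OF assms(1)] assms(3)] by simp
qed

lemma sends_assoc:
  assumes a: "element C S x y a" and b: "element C T y z b" and c: "element C K z w c"
  shows "sends C (\<a> K T S) ((K \<odot> T) \<odot> S) (K \<odot> (T \<odot> S)) x w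
    (lift C (K \<odot> T) S a (lift C K T b c)) (lift C K (T \<odot> S) (lift C T S a b) c)"
proof -
  note S = elementD(6)[OF a] and T = elementD(6)[OF b] and K = elementD(6)[OF c]
  note KT = hcomp_in_spans[OF T K]
  note P = hcomp_in_spans[OF S KT]
  let ?s = "pr0 C (K \<odot> T) S" and ?q = "pr1 C (K \<odot> T) S"
  let ?t = "pr0 C K T \<bullet> ?q" and ?k = "pr1 C K T \<bullet> ?q"
  note s = element_pr[OF S KT]
  obtain v where t: "element C T (leg1 S \<bullet> ?s) v ?t" and k: "element C K v (leg1 ((K \<odot> T) \<odot> S)) ?k"
    using element_hcompE[OF s(2) T K] by metis
  note st = lift_element[OF s(1) t]
  note g = lift_element[OF st k]
  let ?h = "lift C (K \<odot> T) S a (lift C K T b c)"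
  note bc = lift_element[OF b c]
  note h = lift_element[OF a bc]
  have ds: "Dom C ?s = apex C ((K \<odot> T) \<odot> S)"
    using pr_in_hom(1)[OF S KT] homD(1) by blast
  have dst: "Dom C (lift C T S ?s ?t) = apex C ((K \<odot> T) \<odot> S)"
    using lift_in_hom[OF s(1) t] ds homD(1) by metis
  have hh: "?h \<in> hom C (Dom C ?h) (apex C ((K \<odot> T) \<odot> S))" by (rule elementD(1)[OF h])
  have q: "?q \<bullet> ?h = lift C K T b c" by (rule pr1_lift[OF a bc])
  have "?s \<bullet> ?h = a" by (rule pr0_lift[OF a bc])
  moreover have "?t \<bullet> ?h = b"
    using Comp_assoc[OF hh pr_in_hom(2)[OF S KT] pr_in_hom(1)[OF T K]] q pr0_lift[OF b c] by simp
  moreover have "?k \<bullet> ?h = c"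
    using Comp_assoc[OF hh pr_in_hom(2)[OF S KT] pr_in_hom(2)[OF T K]] q pr1_lift[OF b c] by simp
  ultimately have "lift C K (T \<odot> S) (lift C T S ?s ?t) ?k \<bullet> ?h = lift C K (T \<odot> S) (lift C T S a b) c"
    using lift_comp[OF st k hh[folded dst]] lift_comp[OF s(1) t hh[folded ds]] by simp
  then show ?thesis
    using sends_generic[OF g P h] by (simp add: assoc_def)
qed

text \<open>The opposite rebracketing, which turns out to be the inverse of the associativity constraint.\<close>

lemma sends_disassoc:
  assumes a: "element C S x y a" and b: "element C T y z b" and c: "element C K z w c"
  shows "sends C (Cell (K \<odot> (T \<odot> S))
       (lift C (K \<odot> T) S (pr0 C T S \<bullet> pr0 C K (T \<odot> S))
         (lift C K T (pr1 C T S \<bullet> pr0 C K (T \<odot> S)) (pr1 C K (T \<odot> S))))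
       ((K \<odot> T) \<odot> S)) (K \<odot> (T \<odot> S)) ((K \<odot> T) \<odot> S) x w
    (lift C K (T \<odot> S) (lift C T S a b) c) (lift C (K \<odot> T) S a (lift C K T b c))"
proof -
  note S = elementD(6)[OF a] and T = elementD(6)[OF b] and K = elementD(6)[OF c]
  note TS = hcomp_in_spans[OF S T]
  note P = hcomp_in_spans[OF TS K]
  let ?k = "pr1 C K (T \<odot> S)" and ?q = "pr0 C K (T \<odot> S)"
  let ?s = "pr0 C T S \<bullet> ?q" and ?t = "pr1 C T S \<bullet> ?q"
  note k = element_pr[OF TS K]
  obtain v where s: "element C S (leg0 (K \<odot> (T \<odot> S))) v ?s"
      and t: "element C T v (leg1 (T \<odot> S) \<bullet> ?q) ?t"
    using element_hcompE[OF k(1) S T] by metis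
  note tk = lift_element[OF t k(2)]
  note g = lift_element[OF s tk]
  let ?h = "lift C K (T \<odot> S) (lift C T S a b) c"
  note ab = lift_element[OF a b]
  note h = lift_element[OF ab c]
  have ds: "Dom C ?s = apex C (K \<odot> (T \<odot> S))" "Dom C ?t = apex C (K \<odot> (T \<odot> S))"
    using pr_in_hom(1)[OF TS K] pr_in_hom(1,2)[OF S T] Comp_in_hom homD(1) by blast+
  have hh: "?h \<in> hom C (Dom C ?h) (apex C (K \<odot> (T \<odot> S)))" by (rule elementD(1)[OF h])
  have q: "?q \<bullet> ?h = lift C T S a b" by (rule pr0_lift[OF ab c])
  have "?k \<bullet> ?h = c" by (rule pr1_lift[OF ab c])
  moreover have "?s \<bullet> ?h = a"
    using Comp_assoc[OF hh pr_in_hom(1)[OF TS K] pr_in_hom(1)[OF S T]] q pr0_lift[OF a b] by simp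
  moreover have "?t \<bullet> ?h = b"
    using Comp_assoc[OF hh pr_in_hom(1)[OF TS K] pr_in_hom(2)[OF S T]] q pr1_lift[OF a b] by simp
  ultimately have "lift C (K \<odot> T) S ?s (lift C K T ?t ?k) \<bullet> ?h = lift C (K \<odot> T) S a (lift C K T b c)"
    using lift_comp[OF s tk hh[folded ds(1)]] lift_comp[OF t k(2) hh[folded ds(2)]] by simp
  then show ?thesis
    using sends_generic[OF g P h] by simp
qed

lemma sends_assoc_inv:
  assumes a: "element C S x y a" and b: "element C T y z b" and c: "element C K z w c"
  shows "sends C ((\<a> K T S)\<^sup>-\<^sup>1) (K \<odot> (T \<odot> S)) ((K \<odot> T) \<odot> S) x w
    (lift C K (T \<odot> S) (lift C T S a b) c) (lift C (K \<odot> T) S a (lift C K T b c))"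
proof -
  let ?d = "Cell (K \<odot> (T \<odot> S))
       (lift C (K \<odot> T) S (pr0 C T S \<bullet> pr0 C K (T \<odot> S))
         (lift C K T (pr1 C T S \<bullet> pr0 C K (T \<odot> S)) (pr1 C K (T \<odot> S))))
       ((K \<odot> T) \<odot> S)"
  note S = elementD(6)[OF a] and T = elementD(6)[OF b] and K = elementD(6)[OF c]
  note TS = hcomp_in_spans[OF S T] and KT = hcomp_in_spans[OF T K]
  have "inverse_cells C (\<a> K T S) ?d"
  proof (rule inverse_cellsI[OF hcomp_in_spans[OF S KT] hcomp_in_spans[OF TS K]])
    fix x' w' h assume "element C ((K \<odot> T) \<odot> S) x' w' h"
    then obtain y' q a' where "element C S x' y' a'" "element C (K \<odot> T) y' w' q"
        "h = lift C (K \<odot> T) S a' q"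
      using element_hcompE S KT by metis
    moreover from this obtain z' b' c' where "element C T y' z' b'" "element C K z' w' c'"
        "q = lift C K T b' c'"
      using element_hcompE T K by metis
    ultimately show "\<exists>k. sends C (\<a> K T S) ((K \<odot> T) \<odot> S) (K \<odot> (T \<odot> S)) x' w' h k
        \<and> sends C ?d (K \<odot> (T \<odot> S)) ((K \<odot> T) \<odot> S) x' w' k h"
      using sends_assoc sends_disassoc by metis
  next
    fix x' w' h assume "element C (K \<odot> (T \<odot> S)) x' w' h"
    then obtain z' q c' where "element C (T \<odot> S) x' z' q" "element C K z' w' c'"
        "h = lift C K (T \<odot> S) q c'"
      using element_hcompE TS K by metis
    moreover from this obtain y' a' b' where "element C S x' y' a'" "element C T y' z' b'"
        "q = lift C T S a' b'"
      using element_hcompE S T by metis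
    ultimately show "\<exists>k. sends C (\<a> K T S) ((K \<odot> T) \<odot> S) (K \<odot> (T \<odot> S)) x' w' k h
        \<and> sends C ?d (K \<odot> (T \<odot> S)) ((K \<odot> T) \<odot> S) x' w' h k"
      using sends_assoc sends_disassoc by metis
  qed
  then show ?thesis
    using inv_cell_eq sends_disassoc[OF assms] by metis
qed

lemma id_span_in_spans: "U \<in> Obj C \<Longrightarrow> id_span C U \<in> spans C U U"
  using Id_in_hom[of U] homD(1)[OF Id_in_hom[of U]] by (simp add: spans_def id_span_def apex_def)

lemma apex_id_span: "U \<in> Obj C \<Longrightarrow> apex C (id_span C U) = U"
  using homD(1)[OF Id_in_hom] by (simp add: id_span_def apex_def)

lemma element_id_span:
  assumes "point C U x" shows "element C (id_span C U) x x x"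
proof -
  have x: "x \<in> hom C (Dom C x) U" using assms by (simp add: point_def)
  note U = homD(5)[OF x]
  have "x \<in> hom C (Dom C x) (apex C (id_span C U))" using x apex_id_span[OF U] by simp
  then show ?thesis
    by (rule elementI[OF id_span_in_spans[OF U]]) (simp_all add: Id_Comp[OF x] id_span_def)
qed

lemma element_id_spanD:
  assumes "element C (id_span C U) x y h" "U \<in> Obj C"
  shows "h = x" "y = x" "point C U x"
proof -
  have h: "h \<in> hom C (Dom C h) U"
    using elementD(1)[OF assms(1)] apex_id_span[OF assms(2)] by simp
  show "h = x" "y = x"
    using elementD(2,3)[OF assms(1)] Id_Comp[OF h] by (simp_all add: id_span_def)
  then show "point C U x" using h by (simp add: point_def)
qed

text \<open>Over an identity span both legs of an element are the element itself, so the unit constraints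
  delete a component that carries no information.\<close>

lemma sends_lunit:
  assumes "S \<in> spans C U V" "element C S x y a"
  shows "sends C (\<l> S) (id_span C V \<odot> S) S x y (lift C (id_span C V) S a y) a"
proof -
  have V: "Cod C (leg1 S) = V" "V \<in> Obj C"
    using spansD(2)[OF assms(1)] homD by blast+
  note I = id_span_in_spans[OF V(2)]
  note p = element_pr[OF assms(1) I]
  note i = element_id_span[OF element_points(2)[OF assms(2,1)]]
  have "element C S (leg0 (id_span C V \<odot> S)) (leg1 (id_span C V \<odot> S)) (pr0 C (id_span C V) S)"
    using p(1) element_id_spanD[OF p(2) V(2)] by simp
  from sends_generic[OF this hcomp_in_spans[OF assms(1) I] lift_element[OF assms(2) i]]
  show ?thesis using V(1) pr0_lift[OF assms(2) i] by (simp add: lunit_def Let_def)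
qed

lemma sends_runit:
  assumes "S \<in> spans C U V" "element C S x y a"
  shows "sends C (\<r> S) (S \<odot> id_span C U) S x y (lift C S (id_span C U) x a) a"
proof -
  have U: "Cod C (leg0 S) = U" "U \<in> Obj C"
    using spansD(1)[OF assms(1)] homD by blast+
  note I = id_span_in_spans[OF U(2)]
  note p = element_pr[OF I assms(1)]
  note i = element_id_span[OF element_points(1)[OF assms(2,1)]]
  have "element C S (leg0 (S \<odot> id_span C U)) (leg1 (S \<odot> id_span C U)) (pr1 C S (id_span C U))"
    using p(2) element_id_spanD[OF p(1) U(2)] by simp
  from sends_generic[OF this hcomp_in_spans[OF I assms(1)] lift_element[OF i assms(2)]]
  show ?thesis using U(1) pr1_lift[OF i assms(2)] by (simp add: runit_def Let_def)
qed

lemma sends_lunit_inv: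
  assumes "S \<in> spans C U V" "element C S x y a"
  shows "sends C ((\<l> S)\<^sup>-\<^sup>1) S (id_span C V \<odot> S) x y a (lift C (id_span C V) S a y)"
proof -
  have V: "V \<in> Obj C" using spansD(2)[OF assms(1)] homD by blast
  note I = id_span_in_spans[OF V]
  let ?d = "Cell S (lift C (id_span C V) S (Id C (apex C S)) (leg1 S)) (id_span C V \<odot> S)"
  have d: "sends C ?d S (id_span C V \<odot> S) x' y' a' (lift C (id_span C V) S a' y')"
    if a': "element C S x' y' a'" for x' y' a'
  proof -
    note g = element_generic[OF assms(1)]
    note i = element_id_span[OF element_points(2)[OF g assms(1)]]
    note e = elementD[OF a']
    have ob: "Dom C (Id C (apex C S)) = apex C S"
      using Id_in_hom[OF homD(5)[OF e(1)]] homD(1) by blast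
    show ?thesis
      using sends_generic[OF lift_element[OF g i] assms(1) a']
        lift_comp[OF g i, unfolded ob, OF e(1)] Id_Comp[OF e(1)] e(3) by simp
  qed
  have "inverse_cells C (\<l> S) ?d"
  proof (rule inverse_cellsI[OF hcomp_in_spans[OF assms(1) I] assms(1)])
    fix x' y' h assume "element C (id_span C V \<odot> S) x' y' h"
    then obtain z a' b where "element C S x' z a'" "element C (id_span C V) z y' b"
        "h = lift C (id_span C V) S a' b"
      using element_hcompE assms(1) I by metis
    then have "element C S x' y' a'" "h = lift C (id_span C V) S a' y'"
      using element_id_spanD[OF _ V] by metis+
    then show "\<exists>k. sends C (\<l> S) (id_span C V \<odot> S) S x' y' h k
        \<and> sends C ?d S (id_span C V \<odot> S) x' y' k h"
      using d sends_lunit[OF assms(1)] by blast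
  next
    fix x' y' a' assume "element C S x' y' a'"
    then show "\<exists>h. sends C (\<l> S) (id_span C V \<odot> S) S x' y' h a'
        \<and> sends C ?d S (id_span C V \<odot> S) x' y' a' h"
      using d sends_lunit[OF assms(1)] by blast
  qed
  then show ?thesis using inv_cell_eq d[OF assms(2)] by metis
qed

lemma sends_runit_inv:
  assumes "S \<in> spans C U V" "element C S x y a"
  shows "sends C ((\<r> S)\<^sup>-\<^sup>1) S (S \<odot> id_span C U) x y a (lift C S (id_span C U) x a)"
proof -
  have U: "U \<in> Obj C" using spansD(1)[OF assms(1)] homD by blast
  note I = id_span_in_spans[OF U]
  let ?d = "Cell S (lift C S (id_span C U) (leg0 S) (Id C (apex C S))) (S \<odot> id_span C U)"
  have d: "sends C ?d S (S \<odot> id_span C U) x' y' a' (lift C S (id_span C U) x' a')"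
    if a': "element C S x' y' a'" for x' y' a'
  proof -
    note g = element_generic[OF assms(1)]
    note i = element_id_span[OF element_points(1)[OF g assms(1)]]
    note e = elementD[OF a']
    have ob: "Dom C (leg0 S) = apex C S" by (simp add: apex_def)
    show ?thesis
      using sends_generic[OF lift_element[OF i g] assms(1) a']
        lift_comp[OF i g, unfolded ob, OF e(1)] Id_Comp[OF e(1)] e(2) by simp
  qed
  have "inverse_cells C (\<r> S) ?d"
  proof (rule inverse_cellsI[OF hcomp_in_spans[OF I assms(1)] assms(1)])
    fix x' y' h assume "element C (S \<odot> id_span C U) x' y' h"
    then obtain z a' b where "element C (id_span C U) x' z b" "element C S z y' a'"
        "h = lift C S (id_span C U) b a'"
      using element_hcompE assms(1) I by metis
    then have "element C S x' y' a'" "h = lift C S (id_span C U) x' a'"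
      using element_id_spanD[OF _ U] by metis+
    then show "\<exists>k. sends C (\<r> S) (S \<odot> id_span C U) S x' y' h k
        \<and> sends C ?d S (S \<odot> id_span C U) x' y' k h"
      using d sends_runit[OF assms(1)] by blast
  next
    fix x' y' a' assume "element C S x' y' a'"
    then show "\<exists>h. sends C (\<r> S) (S \<odot> id_span C U) S x' y' h a'
        \<and> sends C ?d S (S \<odot> id_span C U) x' y' a' h"
      using d sends_runit[OF assms(1)] by blast
  qed
  then show ?thesis using inv_cell_eq d[OF assms(2)] by metis
qed

text \<open>For a 2-cell that is only assumed to be invertible, such as a core, the inverse is known through
  its graph.\<close>

lemma sends_inv_cell:
  assumes "invertible_cell C r" "sends C r S T x y h k"
  shows "sends C (r\<^sup>-\<^sup>1) T S x y k h"
  using assms inv_cell_eq sends_inverse unfolding invertible_cell_def by metis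

lemma inv_cell_in_cells:
  assumes "invertible_cell C r" "r \<in> cells C S T"
  shows "r\<^sup>-\<^sup>1 \<in> cells C T S"
  using assms inv_cell_eq cellsD(1,2) unfolding invertible_cell_def inverse_cells_def by metis

lemma sends_inv_cell_converse:
  assumes "invertible_cell C r" "sends C (r\<^sup>-\<^sup>1) T S x y k h"
  shows "sends C r S T x y h k"
proof -
  have "inverse_cells C (r\<^sup>-\<^sup>1) r"
    using assms(1) inv_cell_eq cellsD(1,2) unfolding invertible_cell_def inverse_cells_def by metis
  then show ?thesis using sends_inverse assms(2) by blast
qed

section \<open>The spans of a morphism\<close>

lemma apex_star:
  assumes "f \<in> hom C U V" shows "apex C (f\<^sub>\<star>) = U" "apex C (f\<^sup>\<star>) = U"
  using homD(1)[OF assms] homD(1)[OF Id_in_hom[OF homD(4)[OF assms]]]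
  by (simp_all add: lower_star_def upper_star_def apex_def)

lemma lower_star_in_spans:
  assumes "f \<in> hom C U V" shows "f\<^sub>\<star> \<in> spans C U V"
  using assms Id_in_hom[OF homD(4)[OF assms]] apex_star(1)[OF assms] homD(1)[OF assms]
  by (simp add: spans_def lower_star_def)

lemma upper_star_in_spans:
  assumes "f \<in> hom C U V" shows "f\<^sup>\<star> \<in> spans C V U"
  using assms Id_in_hom[OF homD(4)[OF assms]] apex_star(2)[OF assms] homD(1)[OF assms]
  by (simp add: spans_def upper_star_def)

lemma point_comp: "f \<in> hom C U V \<Longrightarrow> point C U x \<Longrightarrow> point C V (f \<bullet> x)"
  using Comp_in_hom homD(1) unfolding point_def by metis

text \<open>An element of \<open>f\<^sub>\<star>\<close> or \<open>f\<^sup>\<star>\<close> is just a point \<open>x\<close> of the domain of \<open>f\<close>; the other leg is \<open>f x\<close>.\<close>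

lemma element_lower_star:
  assumes "f \<in> hom C U V" "point C U x" shows "element C (f\<^sub>\<star>) x (f \<bullet> x) x"
proof -
  have x: "x \<in> hom C (Dom C x) U" using assms(2) by (simp add: point_def)
  have "x \<in> hom C (Dom C x) (apex C (f\<^sub>\<star>))" using x apex_star(1)[OF assms(1)] by simp
  then show ?thesis
    by (rule elementI[OF lower_star_in_spans[OF assms(1)]])
      (simp_all add: Id_Comp[OF x] lower_star_def homD(1)[OF assms(1)])
qed

lemma element_upper_star:
  assumes "f \<in> hom C U V" "point C U x" shows "element C (f\<^sup>\<star>) (f \<bullet> x) x x"
proof -
  have x: "x \<in> hom C (Dom C x) U" using assms(2) by (simp add: point_def)
  have "x \<in> hom C (Dom C x) (apex C (f\<^sup>\<star>))" using x apex_star(2)[OF assms(1)] by simp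
  then show ?thesis
    by (rule elementI[OF upper_star_in_spans[OF assms(1)]])
      (simp_all add: Id_Comp[OF x] upper_star_def homD(1)[OF assms(1)])
qed

lemma element_lower_starD:
  assumes "element C (f\<^sub>\<star>) x y h" "f \<in> hom C U V"
  shows "point C U x" "y = f \<bullet> x" "h = x"
proof -
  have h: "h \<in> hom C (Dom C h) U"
    using elementD(1)[OF assms(1)] apex_star(1)[OF assms(2)] by simp
  show "h = x" "y = f \<bullet> x"
    using elementD(2,3)[OF assms(1)] Id_Comp[OF h] homD(1)[OF assms(2)] by (auto simp: lower_star_def)
  then show "point C U x" using h by (simp add: point_def)
qed

lemma element_upper_starD:
  assumes "element C (f\<^sup>\<star>) x y h" "f \<in> hom C U V"
  shows "point C U y" "x = f \<bullet> y" "h = y"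
proof -
  have h: "h \<in> hom C (Dom C h) U"
    using elementD(1)[OF assms(1)] apex_star(2)[OF assms(2)] by simp
  show "h = y" "x = f \<bullet> y"
    using elementD(2,3)[OF assms(1)] Id_Comp[OF h] homD(1)[OF assms(2)] by (auto simp: upper_star_def)
  then show "point C U y" using h by (simp add: point_def)
qed

text \<open>A pair over \<open>f\<^sup>\<star>\<close> and \<open>f\<^sub>\<star>\<close> repeats one point \<open>x\<close>, which the counit sends to \<open>f x\<close>.\<close>

lemma sends_counit:
  assumes f: "f \<in> hom C U V" and x: "point C U x"
  shows "sends C (\<epsilon> f) (f\<^sub>\<star> \<odot> f\<^sup>\<star>) (id_span C V) (f \<bullet> x) (f \<bullet> x) (lift C (f\<^sub>\<star>) (f\<^sup>\<star>) x x) (f \<bullet> x)"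
proof -
  note L = lower_star_in_spans[OF f] and R = upper_star_in_spans[OF f]
  note p = element_pr[OF R L] and P = hcomp_in_spans[OF R L]
  note gen = element_generic[OF P]
  have "leg1 (f\<^sub>\<star> \<odot> f\<^sup>\<star>) = leg0 (f\<^sub>\<star> \<odot> f\<^sup>\<star>)"
    using element_upper_starD(2)[OF p(1) f] element_lower_starD(2)[OF p(2) f] by simp
  then have g: "element C (id_span C V) (leg0 (f\<^sub>\<star> \<odot> f\<^sup>\<star>)) (leg1 (f\<^sub>\<star> \<odot> f\<^sup>\<star>)) (leg0 (f\<^sub>\<star> \<odot> f\<^sup>\<star>))"
    using element_id_span[OF element_points(1)[OF gen P]] by simp
  note l = lift_element[OF element_upper_star[OF f x] element_lower_star[OF f x]]
  show ?thesis
    using sends_generic[OF g P l] elementD(2)[OF l] homD(2)[OF f] by (simp add: counit_cell_def)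
qed

end

text \<open>The unit of \<open>f\<^sub>\<star> \<stileturn> f\<^sup>\<star>\<close>, that is the diagonal into the kernel pair of \<open>f\<close>. It serves to form mates.\<close>

definition star_unit :: "('o, 'a, 'm) pb_category_scheme \<Rightarrow> 'a \<Rightarrow> 'a cell" where
  "star_unit C f = Cell (id_span C (Dom C f))
     (lift C (f\<^sup>\<star>) (f\<^sub>\<star>) (Id C (Dom C f)) (Id C (Dom C f))) (f\<^sup>\<star> \<odot> f\<^sub>\<star>)" for C (structure)

lemma (in category_with_pullbacks) sends_star_unit:
  assumes f: "f \<in> hom C U V" and x: "point C U x"
  shows "sends C (star_unit C f) (id_span C U) (f\<^sup>\<star> \<odot> f\<^sub>\<star>) x x x (lift C (f\<^sup>\<star>) (f\<^sub>\<star>) x x)"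
proof -
  have i: "Id C U \<in> hom C U U" using Id_in_hom homD(4)[OF f] by blast
  then have pi: "point C U (Id C U)" using homD(1) by (metis point_def)
  note e = element_lower_star[OF f pi] element_upper_star[OF f pi]
  have g: "element C (f\<^sup>\<star> \<odot> f\<^sub>\<star>) (leg0 (id_span C U)) (leg1 (id_span C U)) (lift C (f\<^sup>\<star>) (f\<^sub>\<star>) (Id C U) (Id C U))"
    using lift_element[OF e] by (simp add: id_span_def)
  have x': "x \<in> hom C (Dom C x) (Dom C (Id C U))"
    using x homD(1)[OF i] by (simp add: point_def)
  have "Id C U \<bullet> x = x" using x Id_Comp by (simp add: point_def)
  then show ?thesis
    using sends_generic[OF g id_span_in_spans[OF homD(4)[OF f]] element_id_span[OF x]]
      lift_comp[OF e x'] homD(1)[OF f] by (simp add: star_unit_def)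
qed

context category_with_pullbacks
begin

lemma lift_eq_right:
  assumes "lift C T S a b = lift C T S a b'" "element C S x y a" "element C T y z b" "element C T y z b'"
  shows "b = b'"
  using pr1_lift[OF assms(2,3)] pr1_lift[OF assms(2,4)] assms(1) by metis

text \<open>The form in which an equation of pastings is traded for an equation on elements: the index \<open>i\<close>
  ranges over the decompositions of elements of the source span into nested pairs.\<close>

lemma cells_eq_iff:
  assumes "S \<in> spans C U V"
    and cover: "\<And>x y h. element C S x y h \<Longrightarrow> \<exists>i. P i \<and> x = X i \<and> y = Y i \<and> h = H i"
    and l: "\<And>i. P i \<Longrightarrow> sends C l S T (X i) (Y i) (H i) (L i)"
    and r: "\<And>i. P i \<Longrightarrow> sends C r S T (X i) (Y i) (H i) (R i)"
  shows "l = r \<longleftrightarrow> (\<forall>i. P i \<longrightarrow> L i = R i)"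
proof
  assume "l = r"
  then show "\<forall>i. P i \<longrightarrow> L i = R i" using sends_unique l r by blast
next
  assume "\<forall>i. P i \<longrightarrow> L i = R i"
  then have "\<exists>k. sends C l S T x y h k \<and> sends C r S T x y h k" if "element C S x y h" for x y h
    using cover[OF that] l r by metis
  then show "l = r" by (rule cells_eqI[OF assms(1)])
qed

lemma lift_eq_iff:
  assumes "element C S x y a" "element C T y z b" "element C T y z b'"
  shows "lift C T S a b = lift C T S a b' \<longleftrightarrow> b = b'"
  using lift_eq_right[OF _ assms] by blast

text \<open>Resolution with these rules evaluates a pasting. Their premises are ordered so that the value
  of the factor applied first is known when the next factor is reached.\<close>

lemmas sends_rules = sends_vcomp sends_whisker_left sends_whisker_right sends_assoc sends_assoc_inv
  sends_lunit sends_lunit_inv sends_runit sends_runit_inv sends_counit sends_star_unit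
lemmas element_rules = lift_element element_id_span element_lower_star element_upper_star
lemmas spans_rules = hcomp_in_spans lower_star_in_spans upper_star_in_spans id_span_in_spans
lemmas eval = sends_rules element_rules spans_rules

end

section \<open>Internal categories and functors on elements\<close>

context internal_category
begin

definition times :: "'a \<Rightarrow> 'a \<Rightarrow> 'a" (infixr "\<otimes>" 70) where
  "s \<otimes> t = arr \<mu> \<bullet> lift C S S s t"

definition one :: "'a \<Rightarrow> 'a" where
  "one a = arr \<eta> \<bullet> a"

lemma sends_mult: "element C S a b s \<Longrightarrow> element C S b c t \<Longrightarrow>
    sends C \<mu> (S \<odot> S) S a c (lift C S S s t) (s \<otimes> t)"
  unfolding times_def by (rule sends_cell[OF mult span lift_element])

lemma sends_unit: "point C A a \<Longrightarrow> sends C \<eta> (id_span C A) S a a a (one a)"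
  unfolding one_def by (rule sends_cell[OF unit span element_id_span])

lemma element_times: "element C S a b s \<Longrightarrow> element C S b c t \<Longrightarrow> element C S a c (s \<otimes> t)"
  using sends_mult sendsD(3) by blast

lemma element_one: "point C A a \<Longrightarrow> element C S a a (one a)"
  using sends_unit sendsD(3) by blast

lemma element_point: "element C S a b s \<Longrightarrow> point C A a" "element C S a b s \<Longrightarrow> point C A b"
  using element_points span by blast+

lemma times_assoc:
  assumes "element C S a b s" "element C S b c t" "element C S c d k"
  shows "(s \<otimes> t) \<otimes> k = s \<otimes> (t \<otimes> k)"
proof -
  let ?h = "lift C (S \<odot> S) S s (lift C S S t k)"
  have "sends C (\<mu> \<cdot> (\<mu> \<lhd> S)) ((S \<odot> S) \<odot> S) S a d ?h (s \<otimes> (t \<otimes> k))"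
    by (rule eval sends_mult assms element_times)+
  moreover have "sends C (\<mu> \<cdot> (S \<rhd> \<mu>) \<cdot> \<a> S S S) ((S \<odot> S) \<odot> S) S a d ?h ((s \<otimes> t) \<otimes> k)"
    by (rule eval sends_mult assms element_times)+
  ultimately show ?thesis unfolding mult_assoc by (rule sends_unique[symmetric])
qed

lemma one_times:
  assumes "element C S a b s"
  shows "one a \<otimes> s = s"
proof -
  note a = element_point[OF assms]
  let ?h = "lift C S (id_span C A) a s"
  have "sends C (\<mu> \<cdot> (S \<rhd> \<eta>)) (S \<odot> id_span C A) S a b ?h (one a \<otimes> s)"
    by (rule eval sends_mult sends_unit assms a element_times element_one)+
  moreover have "sends C (\<r> S) (S \<odot> id_span C A) S a b ?h s"
    by (rule eval assms span)+
  ultimately show ?thesis unfolding unit_right by (rule sends_unique)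
qed

lemma times_one:
  assumes "element C S a b s"
  shows "s \<otimes> one b = s"
proof -
  note a = element_point[OF assms]
  let ?h = "lift C (id_span C A) S s b"
  have "sends C (\<mu> \<cdot> (\<eta> \<lhd> S)) (id_span C A \<odot> S) S a b ?h (s \<otimes> one b)"
    by (rule eval sends_mult sends_unit assms a element_times element_one)+
  moreover have "sends C (\<l> S) (id_span C A \<odot> S) S a b ?h s"
    by (rule eval assms span)+
  ultimately show ?thesis unfolding unit_left by (rule sends_unique)
qed

end

text \<open>The data of an internal functor without its laws, so that the laws can be translated one by
  one.\<close>

locale functor_cell =
  XT: internal_category C X T \<eta>\<^sub>T \<mu>\<^sub>T + AS: internal_category C A S \<eta>\<^sub>S \<mu>\<^sub>S
  for C :: "('o, 'a, 'm) pb_category_scheme" (structure)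
    and X T \<eta>\<^sub>T \<mu>\<^sub>T and A S \<eta>\<^sub>S \<mu>\<^sub>S +
  fixes f :: 'a and \<phi> :: "'a cell"
  assumes arrow: "f \<in> hom C X A"
    and cell: "\<phi> \<in> cells C (f\<^sub>\<star> \<odot> T) (S \<odot> f\<^sub>\<star>)"
begin

text \<open>The action on arrows. The value of \<open>\<phi>\<close> at the pair \<open>(t, y)\<close> with \<open>t : y \<rightarrow> x\<close> has the form \<open>(x, act t)\<close>,
  where only the second component is new.\<close>

definition act :: "'a \<Rightarrow> 'a" where
  "act t = pr1 C S (f\<^sub>\<star>) \<bullet> (arr \<phi> \<bullet> lift C (f\<^sub>\<star>) T t (leg1 T \<bullet> t))"

lemma sends_act:
  assumes t: "element C T x y t"
  shows "sends C \<phi> (f\<^sub>\<star> \<odot> T) (S \<odot> f\<^sub>\<star>) x (f \<bullet> y) (lift C (f\<^sub>\<star>) T t y) (lift C S (f\<^sub>\<star>) x (act t))"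
    and element_act: "element C S (f \<bullet> x) (f \<bullet> y) (act t)"
proof -
  note L = XT.lower_star_in_spans[OF arrow]
  have y: "leg1 T \<bullet> t = y" using XT.elementD(3)[OF t] .
  have "element C (f\<^sub>\<star> \<odot> T) x (f \<bullet> y) (lift C (f\<^sub>\<star>) T t y)"
    by (rule XT.element_rules t arrow XT.element_point(2)[OF t])+
  note s = XT.sends_cell[OF cell XT.hcomp_in_spans[OF L AS.span] this]
  obtain z a b where "element C (f\<^sub>\<star>) x z a" "element C S z (f \<bullet> y) b"
    "arr \<phi> \<bullet> lift C (f\<^sub>\<star>) T t y = lift C S (f\<^sub>\<star>) a b" "b = act t"
    using XT.element_hcompE[OF XT.sendsD(3)[OF s] L AS.span] unfolding act_def y by metis
  then show "sends C \<phi> (f\<^sub>\<star> \<odot> T) (S \<odot> f\<^sub>\<star>) x (f \<bullet> y) (lift C (f\<^sub>\<star>) T t y) (lift C S (f\<^sub>\<star>) x (act t))"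
    "element C S (f \<bullet> x) (f \<bullet> y) (act t)"
    using XT.element_lower_starD[OF _ arrow] s by metis+
qed

lemma preserves_mult_iff:
  "(\<mu>\<^sub>S \<lhd> f\<^sub>\<star>) \<cdot> (\<a> S S (f\<^sub>\<star>))\<^sup>-\<^sup>1 \<cdot> (S \<rhd> \<phi>) \<cdot> \<a> S (f\<^sub>\<star>) T \<cdot> (\<phi> \<lhd> T) =
       \<phi> \<cdot> (f\<^sub>\<star> \<rhd> \<mu>\<^sub>T) \<cdot> \<a> (f\<^sub>\<star>) T T \<longleftrightarrow>
   (\<forall>x y z t t'. element C T x y t \<longrightarrow> element C T y z t' \<longrightarrow>
      AS.times (act t) (act t') = act (XT.times t t'))"
  (is "?l = ?r \<longleftrightarrow> ?E")
proof -
  let ?P = "\<lambda>(x, y, z, t, t'). element C T x y t \<and> element C T y z t'"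
  let ?X = "\<lambda>(x, y, z, t, t'). x" and ?Y = "\<lambda>(x, y, z, t, t'). f \<bullet> z"
    and ?H = "\<lambda>(x, y, z, t, t'). lift C (f\<^sub>\<star> \<odot> T) T t (lift C (f\<^sub>\<star>) T t' z)"
    and ?L = "\<lambda>(x, y, z, t, t'). lift C S (f\<^sub>\<star>) x (AS.times (act t) (act t'))"
    and ?R = "\<lambda>(x, y, z, t, t'). lift C S (f\<^sub>\<star>) x (act (XT.times t t'))"
  note L = XT.lower_star_in_spans[OF arrow]
  have l: "sends C ?l ((f\<^sub>\<star> \<odot> T) \<odot> T) (S \<odot> f\<^sub>\<star>) (?X i) (?Y i) (?H i) (?L i)"
    and r: "sends C ?r ((f\<^sub>\<star> \<odot> T) \<odot> T) (S \<odot> f\<^sub>\<star>) (?X i) (?Y i) (?H i) (?R i)"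
    if "i = (x, y, z, t, t')" "element C T x y t" "element C T y z t'" for i x y z t t'
    unfolding that(1) prod.case
    by (rule XT.eval AS.sends_mult XT.sends_mult sends_act element_act that(2,3) XT.element_times
       AS.element_times arrow XT.element_point[OF that(2)] XT.element_point[OF that(3)])+
  have "?l = ?r \<longleftrightarrow> (\<forall>i. ?P i \<longrightarrow> ?L i = ?R i)"
  proof (rule XT.cells_eq_iff[where X = ?X and Y = ?Y and H = ?H])
    show "(f\<^sub>\<star> \<odot> T) \<odot> T \<in> spans C X A" by (rule XT.spans_rules XT.span arrow)+
  next
    fix x w h assume "element C ((f\<^sub>\<star> \<odot> T) \<odot> T) x w h"
    then obtain y t q where t: "element C T x y t" "element C (f\<^sub>\<star> \<odot> T) y w q"
        "h = lift C (f\<^sub>\<star> \<odot> T) T t q"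
      using XT.element_hcompE XT.span XT.hcomp_in_spans[OF XT.span L] by metis
    obtain z t' b where t': "element C T y z t'" "element C (f\<^sub>\<star>) z w b" "q = lift C (f\<^sub>\<star>) T t' b"
      using XT.element_hcompE[OF t(2) XT.span L] by metis
    have "?P (x, y, z, t, t') \<and> x = ?X (x, y, z, t, t') \<and> w = ?Y (x, y, z, t, t')
      \<and> h = ?H (x, y, z, t, t')"
      using t t' XT.element_lower_starD[OF t'(2) arrow] by simp
    then show "\<exists>i. ?P i \<and> x = ?X i \<and> w = ?Y i \<and> h = ?H i" by (rule exI)
  qed (use l r in auto)
  also have "\<dots> \<longleftrightarrow> ?E"
  proof -
    have "?L (x, y, z, t, t') = ?R (x, y, z, t, t') \<longleftrightarrow>
        AS.times (act t) (act t') = act (XT.times t t')"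
      if t: "element C T x y t" "element C T y z t'" for x y z t t'
      using XT.lift_eq_iff[OF XT.element_lower_star[OF arrow XT.element_point(1)[OF t(1)]]
        AS.element_times[OF t[THEN element_act]] element_act[OF XT.element_times[OF t]]] by simp
    then show ?thesis by auto
  qed
  finally show ?thesis .
qed

lemma preserves_unit_iff:
  "\<phi> \<cdot> (f\<^sub>\<star> \<rhd> \<eta>\<^sub>T) \<cdot> (\<r> (f\<^sub>\<star>))\<^sup>-\<^sup>1 = (\<eta>\<^sub>S \<lhd> f\<^sub>\<star>) \<cdot> (\<l> (f\<^sub>\<star>))\<^sup>-\<^sup>1 \<longleftrightarrow>
   (\<forall>x. point C X x \<longrightarrow> act (XT.one x) = AS.one (f \<bullet> x))"
  (is "?l = ?r \<longleftrightarrow> ?E")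
proof -
  have "?l = ?r \<longleftrightarrow> (\<forall>x. point C X x \<longrightarrow>
      lift C S (f\<^sub>\<star>) x (act (XT.one x)) = lift C S (f\<^sub>\<star>) x (AS.one (f \<bullet> x)))"
  proof (rule XT.cells_eq_iff[OF XT.lower_star_in_spans[OF arrow]])
    fix x w h assume "element C (f\<^sub>\<star>) x w h"
    then show "\<exists>i. point C X i \<and> x = i \<and> w = f \<bullet> i \<and> h = i"
      using XT.element_lower_starD arrow by blast
  qed (assumption | rule XT.eval AS.sends_unit XT.sends_unit sends_act XT.element_one AS.element_one
       arrow XT.point_comp[OF arrow])+
  also have "\<dots> \<longleftrightarrow> ?E"
  proof -
    have "lift C S (f\<^sub>\<star>) x (act (XT.one x)) = lift C S (f\<^sub>\<star>) x (AS.one (f \<bullet> x)) \<longleftrightarrow>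
        act (XT.one x) = AS.one (f \<bullet> x)" if x: "point C X x" for x
      using XT.lift_eq_iff[OF XT.element_lower_star[OF arrow x] element_act[OF XT.element_one[OF x]]
       AS.element_one[OF XT.point_comp[OF arrow x]]] .
    then show ?thesis by blast
  qed
  finally show ?thesis .
qed

end

section \<open>Internal adjunctions on elements\<close>

locale internal_category_pair =
  XT: internal_category C X T \<eta>\<^sub>T \<mu>\<^sub>T + AS: internal_category C A S \<eta>\<^sub>S \<mu>\<^sub>S
  for C :: "('o, 'a, 'm) pb_category_scheme" (structure)
    and X T \<eta>\<^sub>T \<mu>\<^sub>T and A S \<eta>\<^sub>S \<mu>\<^sub>S
begin

abbreviation mult_T (infixr "\<otimes>\<^sub>T" 70) where "t \<otimes>\<^sub>T t' \<equiv> XT.times t t'"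
abbreviation mult_S (infixr "\<otimes>\<^sub>S" 70) where "s \<otimes>\<^sub>S s' \<equiv> AS.times s s'"

end

locale adjunction_cells =
  internal_category_pair C X T \<eta>\<^sub>T \<mu>\<^sub>T A S \<eta>\<^sub>S \<mu>\<^sub>S +
  F: functor_cell C X T \<eta>\<^sub>T \<mu>\<^sub>T A S \<eta>\<^sub>S \<mu>\<^sub>S f \<phi> +
  U: functor_cell C A S \<eta>\<^sub>S \<mu>\<^sub>S X T \<eta>\<^sub>T \<mu>\<^sub>T u \<upsilon>
  for C :: "('o, 'a, 'm) pb_category_scheme" (structure)
    and X T \<eta>\<^sub>T \<mu>\<^sub>T and A S \<eta>\<^sub>S \<mu>\<^sub>S and f \<phi> and u \<upsilon> +
  fixes \<alpha> \<beta> :: "'a cell"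
  assumes counit_in_cells: "\<alpha> \<in> cells C (f\<^sub>\<star> \<odot> u\<^sub>\<star>) S"
    and unit_in_cells: "\<beta> \<in> cells C (id_span C X) (T \<odot> (u\<^sub>\<star> \<odot> f\<^sub>\<star>))"
begin

text \<open>The component \<open>f u a \<rightarrow> a\<close> of the counit at the point \<open>a\<close>.\<close>

definition counit_at :: "'a \<Rightarrow> 'a" where
  "counit_at a = arr \<alpha> \<bullet> lift C (f\<^sub>\<star>) (u\<^sub>\<star>) a (u \<bullet> a)"

text \<open>The component \<open>x \<rightarrow> u f x\<close> of the unit at the point \<open>x\<close>; the other component of the pair \<open>\<beta> x\<close> is
  forced to be \<open>(x, f x)\<close>.\<close>

definition unit_at :: "'a \<Rightarrow> 'a" where
  "unit_at x = pr1 C T (u\<^sub>\<star> \<odot> f\<^sub>\<star>) \<bullet> (arr \<beta> \<bullet> x)"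

lemmas f_spans = XT.lower_star_in_spans[OF F.arrow] XT.upper_star_in_spans[OF F.arrow]
lemmas u_spans = XT.lower_star_in_spans[OF U.arrow]
lemmas f_point = XT.point_comp[OF F.arrow]
lemmas u_point = XT.point_comp[OF U.arrow]
lemmas T_point = XT.element_point
lemmas S_point = AS.element_point

lemma sends_counit_at:
  assumes a: "point C A a"
  shows "sends C \<alpha> (f\<^sub>\<star> \<odot> u\<^sub>\<star>) S a (f \<bullet> u \<bullet> a) (lift C (f\<^sub>\<star>) (u\<^sub>\<star>) a (u \<bullet> a)) (counit_at a)"
  unfolding counit_at_def
  by (rule XT.sends_cell[OF counit_in_cells AS.span]) (rule XT.element_rules F.arrow U.arrow a u_point)+

lemma element_counit_at: "point C A a \<Longrightarrow> element C S a (f \<bullet> u \<bullet> a) (counit_at a)"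
  using sends_counit_at XT.sendsD(3) by blast

lemma sends_unit_at:
  assumes x: "point C X x"
  shows "sends C \<beta> (id_span C X) (T \<odot> (u\<^sub>\<star> \<odot> f\<^sub>\<star>)) x x x
      (lift C T (u\<^sub>\<star> \<odot> f\<^sub>\<star>) (lift C (u\<^sub>\<star>) (f\<^sub>\<star>) x (f \<bullet> x)) (unit_at x))"
    and element_unit_at: "element C T (u \<bullet> f \<bullet> x) x (unit_at x)"
proof -
  note uf = XT.hcomp_in_spans[OF f_spans(1) u_spans]
  note s = XT.sends_cell[OF unit_in_cells XT.hcomp_in_spans[OF uf XT.span] XT.element_id_span[OF x]]
  obtain y a b where k: "element C (u\<^sub>\<star> \<odot> f\<^sub>\<star>) x y a" "element C T y x b"
    "arr \<beta> \<bullet> x = lift C T (u\<^sub>\<star> \<odot> f\<^sub>\<star>) a b" "b = unit_at x"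
    using XT.element_hcompE[OF XT.sendsD(3)[OF s] uf XT.span] unfolding unit_at_def by metis
  obtain z c d where "element C (f\<^sub>\<star>) x z c" "element C (u\<^sub>\<star>) z y d" "a = lift C (u\<^sub>\<star>) (f\<^sub>\<star>) c d"
    using XT.element_hcompE[OF k(1) f_spans(1) u_spans] by metis
  then have "a = lift C (u\<^sub>\<star>) (f\<^sub>\<star>) x (f \<bullet> x)" "y = u \<bullet> f \<bullet> x"
    using XT.element_lower_starD[OF _ F.arrow] XT.element_lower_starD[OF _ U.arrow] by metis+
  then show "sends C \<beta> (id_span C X) (T \<odot> (u\<^sub>\<star> \<odot> f\<^sub>\<star>)) x x x
      (lift C T (u\<^sub>\<star> \<odot> f\<^sub>\<star>) (lift C (u\<^sub>\<star>) (f\<^sub>\<star>) x (f \<bullet> x)) (unit_at x))"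
    "element C T (u \<bullet> f \<bullet> x) x (unit_at x)"
    using k s by metis+
qed

lemmas element_intros = F.element_act U.element_act XT.element_times AS.element_times XT.element_one
  AS.element_one element_unit_at element_counit_at F.arrow U.arrow f_point u_point
  XT.span AS.span
lemmas eval = XT.eval XT.sends_mult AS.sends_mult XT.sends_unit AS.sends_unit F.sends_act
   U.sends_act sends_counit_at sends_unit_at element_intros

lemma counit_natural_iff:
  "\<mu>\<^sub>S \<cdot> (\<alpha> \<lhd> S) = \<mu>\<^sub>S \<cdot> (S \<rhd> \<alpha>) \<cdot> \<a> S (f\<^sub>\<star>) (u\<^sub>\<star>) \<cdot> (\<phi> \<lhd> u\<^sub>\<star>) \<cdot> (\<a> (f\<^sub>\<star>) T (u\<^sub>\<star>))\<^sup>-\<^sup>1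
         \<cdot> (f\<^sub>\<star> \<rhd> \<upsilon>) \<cdot> \<a> (f\<^sub>\<star>) (u\<^sub>\<star>) S \<longleftrightarrow>
   (\<forall>a b s. element C S a b s \<longrightarrow> s \<otimes>\<^sub>S counit_at b = counit_at a \<otimes>\<^sub>S F.act (U.act s))"
  (is "?l = ?r \<longleftrightarrow> ?E")
proof -
  let ?P = "\<lambda>(a, b, s). element C S a b s"
  let ?X = "\<lambda>(a, b, s). a" and ?Y = "\<lambda>(a, b, s). f \<bullet> u \<bullet> b"
    and ?H = "\<lambda>(a, b, s). lift C (f\<^sub>\<star> \<odot> u\<^sub>\<star>) S s (lift C (f\<^sub>\<star>) (u\<^sub>\<star>) b (u \<bullet> b))"
    and ?L = "\<lambda>(a, b, s). s \<otimes>\<^sub>S counit_at b"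
    and ?R = "\<lambda>(a, b, s). counit_at a \<otimes>\<^sub>S F.act (U.act s)"
  note fu = XT.hcomp_in_spans[OF u_spans f_spans(1)]
  have l: "sends C ?l ((f\<^sub>\<star> \<odot> u\<^sub>\<star>) \<odot> S) S (?X i) (?Y i) (?H i) (?L i)"
    and r: "sends C ?r ((f\<^sub>\<star> \<odot> u\<^sub>\<star>) \<odot> S) S (?X i) (?Y i) (?H i) (?R i)"
    if "i = (a, b, s)" "element C S a b s" for i a b s
    unfolding that(1) prod.case
    by (rule eval that(2) S_point[OF that(2)])+
  have "?l = ?r \<longleftrightarrow> (\<forall>i. ?P i \<longrightarrow> ?L i = ?R i)"
  proof (rule XT.cells_eq_iff[where X = ?X and Y = ?Y and H = ?H])
    show "(f\<^sub>\<star> \<odot> u\<^sub>\<star>) \<odot> S \<in> spans C A A" by (rule XT.hcomp_in_spans[OF AS.span fu])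
  next
    fix a c h assume "element C ((f\<^sub>\<star> \<odot> u\<^sub>\<star>) \<odot> S) a c h"
    then obtain b s q where s: "element C S a b s" "element C (f\<^sub>\<star> \<odot> u\<^sub>\<star>) b c q"
        "h = lift C (f\<^sub>\<star> \<odot> u\<^sub>\<star>) S s q"
      using XT.element_hcompE AS.span fu by metis
    obtain z t d where q: "element C (u\<^sub>\<star>) b z t" "element C (f\<^sub>\<star>) z c d" "q = lift C (f\<^sub>\<star>) (u\<^sub>\<star>) t d"
      using XT.element_hcompE[OF s(2) u_spans f_spans(1)] by metis
    have "?P (a, b, s) \<and> a = ?X (a, b, s) \<and> c = ?Y (a, b, s) \<and> h = ?H (a, b, s)"
      using s q XT.element_lower_starD[OF q(1) U.arrow] XT.element_lower_starD[OF q(2) F.arrow] by simp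
    then show "\<exists>i. ?P i \<and> a = ?X i \<and> c = ?Y i \<and> h = ?H i" by (rule exI)
  qed (use l r in auto)
  also have "\<dots> \<longleftrightarrow> ?E" by simp
  finally show ?thesis .
qed

lemma unit_natural_iff:
  "(\<mu>\<^sub>T \<lhd> (u\<^sub>\<star> \<odot> f\<^sub>\<star>)) \<cdot> (\<a> T T (u\<^sub>\<star> \<odot> f\<^sub>\<star>))\<^sup>-\<^sup>1 \<cdot> (T \<rhd> \<beta>) \<cdot> (\<r> T)\<^sup>-\<^sup>1 =
       (\<mu>\<^sub>T \<lhd> (u\<^sub>\<star> \<odot> f\<^sub>\<star>)) \<cdot> (\<a> T T (u\<^sub>\<star> \<odot> f\<^sub>\<star>))\<^sup>-\<^sup>1
         \<cdot> (T \<rhd> (\<a> T (u\<^sub>\<star>) (f\<^sub>\<star>) \<cdot> (\<upsilon> \<lhd> f\<^sub>\<star>)))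
         \<cdot> (T \<rhd> ((\<a> (u\<^sub>\<star>) S (f\<^sub>\<star>))\<^sup>-\<^sup>1 \<cdot> (u\<^sub>\<star> \<rhd> \<phi>) \<cdot> \<a> (u\<^sub>\<star>) (f\<^sub>\<star>) T))
         \<cdot> \<a> T (u\<^sub>\<star> \<odot> f\<^sub>\<star>) T \<cdot> (\<beta> \<lhd> T) \<cdot> (\<l> T)\<^sup>-\<^sup>1 \<longleftrightarrow>
   (\<forall>x y t. element C T x y t \<longrightarrow> unit_at x \<otimes>\<^sub>T t = U.act (F.act t) \<otimes>\<^sub>T unit_at y)"
  (is "?l = ?r \<longleftrightarrow> ?E")
proof -
  let ?P = "\<lambda>(x, y, t). element C T x y t"
  let ?X = "\<lambda>(x, y, t). x" and ?Y = "\<lambda>(x, y, t). y" and ?H = "\<lambda>(x, y, t). t"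
    and ?L = "\<lambda>(x, y, t). lift C T (u\<^sub>\<star> \<odot> f\<^sub>\<star>) (lift C (u\<^sub>\<star>) (f\<^sub>\<star>) x (f \<bullet> x)) (unit_at x \<otimes>\<^sub>T t)"
    and ?R = "\<lambda>(x, y, t). lift C T (u\<^sub>\<star> \<odot> f\<^sub>\<star>) (lift C (u\<^sub>\<star>) (f\<^sub>\<star>) x (f \<bullet> x))
      (U.act (F.act t) \<otimes>\<^sub>T unit_at y)"
  have l: "sends C ?l T (T \<odot> (u\<^sub>\<star> \<odot> f\<^sub>\<star>)) (?X i) (?Y i) (?H i) (?L i)"
    and r: "sends C ?r T (T \<odot> (u\<^sub>\<star> \<odot> f\<^sub>\<star>)) (?X i) (?Y i) (?H i) (?R i)"
    if "i = (x, y, t)" "element C T x y t" for i x y t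
    unfolding that(1) prod.case
    by (rule eval that(2) T_point[OF that(2)])+
  have "?l = ?r \<longleftrightarrow> (\<forall>i. ?P i \<longrightarrow> ?L i = ?R i)"
    by (rule XT.cells_eq_iff[OF XT.span, where X = ?X and Y = ?Y and H = ?H]) (use l r in auto)
  also have "\<dots> \<longleftrightarrow> ?E"
  proof -
    have "?L (x, y, t) = ?R (x, y, t) \<longleftrightarrow> unit_at x \<otimes>\<^sub>T t = U.act (F.act t) \<otimes>\<^sub>T unit_at y"
      if t: "element C T x y t" for x y t
      unfolding prod.case
      by (rule XT.lift_eq_iff) (rule XT.element_rules element_intros t T_point[OF t])+
    then show ?thesis by auto
  qed
  finally show ?thesis .
qed

lemma triangle_left_iff:
  "(\<eta>\<^sub>S \<lhd> f\<^sub>\<star>) \<cdot> (\<l> (f\<^sub>\<star>))\<^sup>-\<^sup>1 =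
       (\<mu>\<^sub>S \<lhd> f\<^sub>\<star>) \<cdot> (\<a> S S (f\<^sub>\<star>))\<^sup>-\<^sup>1
         \<cdot> (S \<rhd> ((\<alpha> \<lhd> f\<^sub>\<star>) \<cdot> (\<a> (f\<^sub>\<star>) (u\<^sub>\<star>) (f\<^sub>\<star>))\<^sup>-\<^sup>1))
         \<cdot> \<a> S (f\<^sub>\<star>) (u\<^sub>\<star> \<odot> f\<^sub>\<star>) \<cdot> (\<phi> \<lhd> (u\<^sub>\<star> \<odot> f\<^sub>\<star>)) \<cdot> (\<a> (f\<^sub>\<star>) T (u\<^sub>\<star> \<odot> f\<^sub>\<star>))\<^sup>-\<^sup>1
         \<cdot> (f\<^sub>\<star> \<rhd> \<beta>) \<cdot> (\<r> (f\<^sub>\<star>))\<^sup>-\<^sup>1 \<longleftrightarrow>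
   (\<forall>x. point C X x \<longrightarrow> AS.one (f \<bullet> x) = counit_at (f \<bullet> x) \<otimes>\<^sub>S F.act (unit_at x))"
  (is "?l = ?r \<longleftrightarrow> ?E")
proof -
  let ?L = "\<lambda>x. lift C S (f\<^sub>\<star>) x (AS.one (f \<bullet> x))"
    and ?R = "\<lambda>x. lift C S (f\<^sub>\<star>) x (counit_at (f \<bullet> x) \<otimes>\<^sub>S F.act (unit_at x))"
  have l: "sends C ?l (f\<^sub>\<star>) (S \<odot> f\<^sub>\<star>) x (f \<bullet> x) x (?L x)"
    and r: "sends C ?r (f\<^sub>\<star>) (S \<odot> f\<^sub>\<star>) x (f \<bullet> x) x (?R x)" if x: "point C X x" for x
    by (rule eval x)+
  have "?l = ?r \<longleftrightarrow> (\<forall>x. point C X x \<longrightarrow> ?L x = ?R x)"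
  proof (rule XT.cells_eq_iff[OF f_spans(1) _ l r])
    fix x w h assume "element C (f\<^sub>\<star>) x w h"
    then show "\<exists>i. point C X i \<and> x = i \<and> w = f \<bullet> i \<and> h = i"
      using XT.element_lower_starD F.arrow by blast
  qed
  also have "\<dots> \<longleftrightarrow> ?E"
  proof -
    have "?L x = ?R x \<longleftrightarrow> AS.one (f \<bullet> x) = counit_at (f \<bullet> x) \<otimes>\<^sub>S F.act (unit_at x)"
      if x: "point C X x" for x
      by (rule XT.lift_eq_iff) (rule XT.element_rules element_intros x)+
    then show ?thesis by auto
  qed
  finally show ?thesis .
qed

lemma triangle_right_iff:
  "(\<eta>\<^sub>T \<lhd> u\<^sub>\<star>) \<cdot> (\<l> (u\<^sub>\<star>))\<^sup>-\<^sup>1 =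
       (\<mu>\<^sub>T \<lhd> u\<^sub>\<star>) \<cdot> (\<a> T T (u\<^sub>\<star>))\<^sup>-\<^sup>1 \<cdot> (T \<rhd> \<upsilon>)
         \<cdot> (T \<rhd> ((u\<^sub>\<star> \<rhd> \<alpha>) \<cdot> \<a> (u\<^sub>\<star>) (f\<^sub>\<star>) (u\<^sub>\<star>)))
         \<cdot> \<a> T (u\<^sub>\<star> \<odot> f\<^sub>\<star>) (u\<^sub>\<star>) \<cdot> (\<beta> \<lhd> u\<^sub>\<star>) \<cdot> (\<l> (u\<^sub>\<star>))\<^sup>-\<^sup>1 \<longleftrightarrow>
   (\<forall>a. point C A a \<longrightarrow> XT.one (u \<bullet> a) = U.act (counit_at a) \<otimes>\<^sub>T unit_at (u \<bullet> a))"
  (is "?l = ?r \<longleftrightarrow> ?E")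
proof -
  let ?L = "\<lambda>a. lift C T (u\<^sub>\<star>) a (XT.one (u \<bullet> a))"
    and ?R = "\<lambda>a. lift C T (u\<^sub>\<star>) a (U.act (counit_at a) \<otimes>\<^sub>T unit_at (u \<bullet> a))"
  have l: "sends C ?l (u\<^sub>\<star>) (T \<odot> u\<^sub>\<star>) a (u \<bullet> a) a (?L a)"
    and r: "sends C ?r (u\<^sub>\<star>) (T \<odot> u\<^sub>\<star>) a (u \<bullet> a) a (?R a)" if a: "point C A a" for a
    by (rule eval a)+
  have "?l = ?r \<longleftrightarrow> (\<forall>a. point C A a \<longrightarrow> ?L a = ?R a)"
  proof (rule XT.cells_eq_iff[OF u_spans _ l r])
    fix x w h assume "element C (u\<^sub>\<star>) x w h"
    then show "\<exists>i. point C A i \<and> x = i \<and> w = u \<bullet> i \<and> h = i"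
      using XT.element_lower_starD U.arrow by blast
  qed
  also have "\<dots> \<longleftrightarrow> ?E"
  proof -
    have "?L a = ?R a \<longleftrightarrow> XT.one (u \<bullet> a) = U.act (counit_at a) \<otimes>\<^sub>T unit_at (u \<bullet> a)"
      if a: "point C A a" for a
      by (rule XT.lift_eq_iff) (rule XT.element_rules element_intros a)+
    then show ?thesis by auto
  qed
  finally show ?thesis .
qed

text \<open>The counit \<open>\<epsilon>\<close> removes the copies of \<open>x\<close> that \<open>\<beta>\<close> has introduced, which leaves the classical formula
  for the transpose of an arrow \<open>s : f x \<rightarrow> a\<close>.\<close>

lemma sends_associated_core:
  assumes s: "element C S a (f \<bullet> x) s" and x: "point C X x"
  shows "sends C (associated_core C T \<mu>\<^sub>T S f u \<upsilon> \<beta>) (f\<^sup>\<star> \<odot> S) (T \<odot> u\<^sub>\<star>) a x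
    (lift C (f\<^sup>\<star>) S s x) (lift C T (u\<^sub>\<star>) a (U.act s \<otimes>\<^sub>T unit_at x))"
  unfolding associated_core_def by (rule eval s x S_point[OF s])+

end

lemma (in category_with_pullbacks) cells_if_sends:
  assumes "S \<in> spans C U V" "\<And>x y h. element C S x y h \<Longrightarrow> \<exists>k. sends C r S T x y h k"
  shows "r \<in> cells C S T"
  using assms(2)[OF element_generic[OF assms(1)]] sendsD(1) by blast

text \<open>An adjunction between the ordinary categories of elements, at all stages at once.\<close>

locale elementwise_adjunction = adjunction_cells +
  assumes F_mult: "element C T x y t \<Longrightarrow> element C T y z t' \<Longrightarrow> F.act t \<otimes>\<^sub>S F.act t' = F.act (t \<otimes>\<^sub>T t')"
    and F_one: "point C X x \<Longrightarrow> F.act (XT.one x) = AS.one (f \<bullet> x)"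
    and U_mult: "element C S a b s \<Longrightarrow> element C S b c s' \<Longrightarrow> U.act s \<otimes>\<^sub>T U.act s' = U.act (s \<otimes>\<^sub>S s')"
    and U_one: "point C A a \<Longrightarrow> U.act (AS.one a) = XT.one (u \<bullet> a)"
    and counit_nat: "element C S a b s \<Longrightarrow> s \<otimes>\<^sub>S counit_at b = counit_at a \<otimes>\<^sub>S F.act (U.act s)"
    and unit_nat: "element C T x y t \<Longrightarrow> unit_at x \<otimes>\<^sub>T t = U.act (F.act t) \<otimes>\<^sub>T unit_at y"
    and triangle_F: "point C X x \<Longrightarrow> AS.one (f \<bullet> x) = counit_at (f \<bullet> x) \<otimes>\<^sub>S F.act (unit_at x)"
    and triangle_U: "point C A a \<Longrightarrow> XT.one (u \<bullet> a) = U.act (counit_at a) \<otimes>\<^sub>T unit_at (u \<bullet> a)"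

lemma (in adjunction_cells) internal_adjunction_iff:
  "internal_adjunction C X T \<eta>\<^sub>T \<mu>\<^sub>T A S \<eta>\<^sub>S \<mu>\<^sub>S f \<phi> u \<upsilon> \<alpha> \<beta> \<longleftrightarrow>
    elementwise_adjunction C X T \<eta>\<^sub>T \<mu>\<^sub>T A S \<eta>\<^sub>S \<mu>\<^sub>S f \<phi> u \<upsilon> \<alpha> \<beta>"
  unfolding internal_adjunction_def internal_functor_def internal_adjunction_axioms_def
    internal_functor_axioms_def elementwise_adjunction_def elementwise_adjunction_axioms_def
    F.preserves_mult_iff F.preserves_unit_iff U.preserves_mult_iff U.preserves_unit_iff
    counit_natural_iff unit_natural_iff triangle_left_iff triangle_right_iff
  by (simp only: adjunction_cells_axioms XT.internal_category_axioms AS.internal_category_axioms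
    F.arrow U.arrow F.cell U.cell counit_in_cells unit_in_cells simp_thms) blast

lemma internal_adjunction_cells:
  assumes "internal_adjunction C X T \<eta>\<^sub>T \<mu>\<^sub>T A S \<eta>\<^sub>S \<mu>\<^sub>S f \<phi> u \<upsilon> \<alpha> \<beta>"
  shows "adjunction_cells C X T \<eta>\<^sub>T \<mu>\<^sub>T A S \<eta>\<^sub>S \<mu>\<^sub>S f \<phi> u \<upsilon> \<alpha> \<beta>"
proof -
  interpret internal_adjunction C X T \<eta>\<^sub>T \<mu>\<^sub>T A S \<eta>\<^sub>S \<mu>\<^sub>S f \<phi> u \<upsilon> \<alpha> \<beta> by (fact assms)
  show ?thesis
    by unfold_locales (fact F.arrow F.cell U.arrow U.cell counit_cell unit_cell)+
qed

section \<open>Adjunction cores\<close>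

locale adjunction_core = internal_category_pair C X T \<eta>\<^sub>T \<mu>\<^sub>T A S \<eta>\<^sub>S \<mu>\<^sub>S
  for C :: "('o, 'a, 'm) pb_category_scheme" (structure)
    and X T \<eta>\<^sub>T \<mu>\<^sub>T and A S \<eta>\<^sub>S \<mu>\<^sub>S +
  fixes f u :: 'a and \<pi> :: "'a cell"
  assumes f_arrow: "f \<in> hom C X A" and u_arrow: "u \<in> hom C A X"
    and core_cell: "\<pi> \<in> cells C (f\<^sup>\<star> \<odot> S) (T \<odot> u\<^sub>\<star>)"
    and core_invertible: "invertible_cell C \<pi>"
begin

text \<open>Transposition takes \<open>s : f x \<rightarrow> a\<close> to an arrow \<open>x \<rightarrow> u a\<close>. The point \<open>x\<close> is an argument because \<open>f x\<close>
  does not determine it; in the other direction \<open>u a\<close> does not determine \<open>a\<close>.\<close>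

definition transpose :: "'a \<Rightarrow> 'a \<Rightarrow> 'a" where
  "transpose s x = pr1 C T (u\<^sub>\<star>) \<bullet> (arr \<pi> \<bullet> lift C (f\<^sup>\<star>) S s x)"

definition untranspose :: "'a \<Rightarrow> 'a \<Rightarrow> 'a" where
  "untranspose a t = pr0 C (f\<^sup>\<star>) S \<bullet> (arr (\<pi>\<^sup>-\<^sup>1) \<bullet> lift C T (u\<^sub>\<star>) a t)"

definition core_unit_at :: "'a \<Rightarrow> 'a" where
  "core_unit_at x = transpose (AS.one (f \<bullet> x)) x"

definition core_counit_at :: "'a \<Rightarrow> 'a" where
  "core_counit_at a = untranspose a (XT.one (u \<bullet> a))"

lemmas f_lower = XT.lower_star_in_spans[OF f_arrow]
lemmas f_upper = XT.upper_star_in_spans[OF f_arrow]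
lemmas u_lower = XT.lower_star_in_spans[OF u_arrow]
lemmas f_point = XT.point_comp[OF f_arrow]
lemmas u_point = XT.point_comp[OF u_arrow]

lemma sends_core:
  assumes s: "element C S a (f \<bullet> x) s" and x: "point C X x"
  shows "sends C \<pi> (f\<^sup>\<star> \<odot> S) (T \<odot> u\<^sub>\<star>) a x (lift C (f\<^sup>\<star>) S s x) (lift C T (u\<^sub>\<star>) a (transpose s x))"
    and element_transpose: "element C T (u \<bullet> a) x (transpose s x)"
proof -
  have e: "element C (f\<^sup>\<star> \<odot> S) a x (lift C (f\<^sup>\<star>) S s x)"
    by (rule XT.element_rules f_arrow s x)+
  note k = XT.sends_cell[OF core_cell XT.hcomp_in_spans[OF u_lower XT.span] e]
  obtain y b t where "element C (u\<^sub>\<star>) a y b" "element C T y x t"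
    "arr \<pi> \<bullet> lift C (f\<^sup>\<star>) S s x = lift C T (u\<^sub>\<star>) b t" "t = transpose s x"
    using XT.element_hcompE[OF XT.sendsD(3)[OF k] u_lower XT.span] unfolding transpose_def by metis
  then show "sends C \<pi> (f\<^sup>\<star> \<odot> S) (T \<odot> u\<^sub>\<star>) a x (lift C (f\<^sup>\<star>) S s x) (lift C T (u\<^sub>\<star>) a (transpose s x))"
    "element C T (u \<bullet> a) x (transpose s x)"
    using XT.element_lower_starD[OF _ u_arrow] k by metis+
qed

lemma sends_core_inv:
  assumes t: "element C T (u \<bullet> a) x t" and a: "point C A a"
  shows "sends C (\<pi>\<^sup>-\<^sup>1) (T \<odot> u\<^sub>\<star>) (f\<^sup>\<star> \<odot> S) a x (lift C T (u\<^sub>\<star>) a t) (lift C (f\<^sup>\<star>) S (untranspose a t) x)"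
    and element_untranspose: "element C S a (f \<bullet> x) (untranspose a t)"
proof -
  have e: "element C (T \<odot> u\<^sub>\<star>) a x (lift C T (u\<^sub>\<star>) a t)"
    by (rule XT.element_rules u_arrow t a)+
  note k = XT.sends_cell[OF XT.inv_cell_in_cells[OF core_invertible core_cell]
      XT.hcomp_in_spans[OF AS.span f_upper] e]
  obtain y b s where "element C S a y s" "element C (f\<^sup>\<star>) y x b"
    "arr (\<pi>\<^sup>-\<^sup>1) \<bullet> lift C T (u\<^sub>\<star>) a t = lift C (f\<^sup>\<star>) S s b" "s = untranspose a t"
    using XT.element_hcompE[OF XT.sendsD(3)[OF k] AS.span f_upper] unfolding untranspose_def by metis
  then show "sends C (\<pi>\<^sup>-\<^sup>1) (T \<odot> u\<^sub>\<star>) (f\<^sup>\<star> \<odot> S) a x (lift C T (u\<^sub>\<star>) a t) (lift C (f\<^sup>\<star>) S (untranspose a t) x)"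
    "element C S a (f \<bullet> x) (untranspose a t)"
    using XT.element_upper_starD[OF _ f_arrow] k by metis+
qed

lemma untranspose_transpose:
  assumes s: "element C S a (f \<bullet> x) s" and x: "point C X x"
  shows "untranspose a (transpose s x) = s"
proof -
  have "lift C (f\<^sup>\<star>) S (untranspose a (transpose s x)) x = lift C (f\<^sup>\<star>) S s x"
    by (rule XT.sends_unique[OF sends_core_inv(1)[OF element_transpose[OF s x] AS.element_point(1)[OF s]]
          XT.sends_inv_cell[OF core_invertible sends_core(1)[OF s x]]])
  then show ?thesis
    using XT.pr0_lift[OF s XT.element_upper_star[OF f_arrow x]]
      XT.pr0_lift[OF element_untranspose[OF element_transpose[OF s x] AS.element_point(1)[OF s]]
        XT.element_upper_star[OF f_arrow x]] by metis
qed

lemma transpose_untranspose: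
  assumes t: "element C T (u \<bullet> a) x t" and a: "point C A a"
  shows "transpose (untranspose a t) x = t"
proof -
  note s = element_untranspose[OF t a] and x = XT.element_point(2)[OF t]
  have "lift C T (u\<^sub>\<star>) a (transpose (untranspose a t) x) = lift C T (u\<^sub>\<star>) a t"
    by (rule XT.sends_unique[OF sends_core(1)[OF s x]
          XT.sends_inv_cell_converse[OF core_invertible sends_core_inv(1)[OF t a]]])
  then show ?thesis
    by (rule XT.lift_eq_right[OF _ XT.element_lower_star[OF u_arrow a] element_transpose[OF s x] t])
qed

lemma transpose_inject:
  assumes "transpose s x = transpose s' x" "element C S a (f \<bullet> x) s" "element C S a (f \<bullet> x) s'"
    "point C X x"
  shows "s = s'"
  using untranspose_transpose assms by metis

lemma element_core_unit_at: "point C X x \<Longrightarrow> element C T (u \<bullet> f \<bullet> x) x (core_unit_at x)"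
  unfolding core_unit_at_def by (rule element_transpose AS.element_one f_point | assumption)+

lemma element_core_counit_at: "point C A a \<Longrightarrow> element C S a (f \<bullet> u \<bullet> a) (core_counit_at a)"
  unfolding core_counit_at_def by (rule element_untranspose XT.element_one u_point | assumption)+

lemma transpose_counit: "point C A a \<Longrightarrow> transpose (core_counit_at a) (u \<bullet> a) = XT.one (u \<bullet> a)"
  unfolding core_counit_at_def by (rule transpose_untranspose[OF XT.element_one[OF u_point]])

lemma untranspose_unit: "point C X x \<Longrightarrow> untranspose (f \<bullet> x) (core_unit_at x) = AS.one (f \<bullet> x)"
  unfolding core_unit_at_def by (rule untranspose_transpose[OF AS.element_one[OF f_point]])

text \<open>The cells called \<open>\<beta>'\<close>, \<open>\<alpha>'\<close>, \<open>\<upsilon>\<close> and \<open>\<psi>\<close> in the theorem. The first two and the last are mates under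
  \<open>f\<^sub>\<star> \<stileturn> f\<^sup>\<star>\<close> of the unit, the counit and the action of the left adjoint.\<close>

definition unit_mate :: "'a cell" where
  "unit_mate = \<pi> \<cdot> (f\<^sup>\<star> \<rhd> \<eta>\<^sub>S) \<cdot> (\<r> (f\<^sup>\<star>))\<^sup>-\<^sup>1"
definition counit_mate :: "'a cell" where
  "counit_mate = \<pi>\<^sup>-\<^sup>1 \<cdot> (\<eta>\<^sub>T \<lhd> u\<^sub>\<star>) \<cdot> (\<l> (u\<^sub>\<star>))\<^sup>-\<^sup>1"
definition right_adjoint_cell :: "'a cell" where
  "right_adjoint_cell = \<pi> \<cdot> (f\<^sup>\<star> \<rhd> \<mu>\<^sub>S) \<cdot> \<a> (f\<^sup>\<star>) S S \<cdot> (counit_mate \<lhd> S)"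
definition left_mate :: "'a cell" where
  "left_mate = \<pi>\<^sup>-\<^sup>1 \<cdot> (\<mu>\<^sub>T \<lhd> u\<^sub>\<star>) \<cdot> (\<a> T T (u\<^sub>\<star>))\<^sup>-\<^sup>1 \<cdot> (T \<rhd> unit_mate)"

lemmas core_intros = element_core_unit_at element_core_counit_at element_transpose
  element_untranspose XT.element_times AS.element_times XT.element_one AS.element_one
  f_arrow u_arrow f_point u_point XT.span AS.span
lemmas core_eval = XT.eval XT.sends_mult AS.sends_mult XT.sends_unit AS.sends_unit sends_core
  sends_core_inv core_intros

lemma sends_unit_mate:
  assumes x: "point C X x"
  shows "sends C unit_mate (f\<^sup>\<star>) (T \<odot> u\<^sub>\<star>) (f \<bullet> x) x x (lift C T (u\<^sub>\<star>) (f \<bullet> x) (core_unit_at x))"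
  unfolding unit_mate_def core_unit_at_def by (rule core_eval x)+

lemma sends_counit_mate:
  assumes a: "point C A a"
  shows "sends C counit_mate (u\<^sub>\<star>) (f\<^sup>\<star> \<odot> S) a (u \<bullet> a) a (lift C (f\<^sup>\<star>) S (core_counit_at a) (u \<bullet> a))"
  unfolding counit_mate_def core_counit_at_def by (rule core_eval a)+

lemma sends_right_adjoint_cell:
  assumes s: "element C S a b s"
  shows "sends C right_adjoint_cell (u\<^sub>\<star> \<odot> S) (T \<odot> u\<^sub>\<star>) a (u \<bullet> b) (lift C (u\<^sub>\<star>) S s b)
    (lift C T (u\<^sub>\<star>) a (transpose (s \<otimes>\<^sub>S core_counit_at b) (u \<bullet> b)))"
  unfolding right_adjoint_cell_def by (rule sends_counit_mate core_eval s AS.element_point[OF s])+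

lemma sends_left_mate:
  assumes t: "element C T x y t"
  shows "sends C left_mate (T \<odot> f\<^sup>\<star>) (f\<^sup>\<star> \<odot> S) (f \<bullet> x) y (lift C T (f\<^sup>\<star>) x t)
    (lift C (f\<^sup>\<star>) S (untranspose (f \<bullet> x) (core_unit_at x \<otimes>\<^sub>T t)) y)"
  unfolding left_mate_def by (rule sends_unit_mate core_eval t XT.element_point[OF t])+

text \<open>Transporting the mates back along \<open>f\<^sub>\<star> \<stileturn> f\<^sup>\<star>\<close> gives the cells \<open>\<phi>\<close>, \<open>\<alpha>\<close> and \<open>\<beta>\<close> of the prospective
  adjunction. Building them as pastings makes them 2-cells with values computed by the same
  rules as above.\<close>

definition left_adjoint_cell :: "'a cell" where
  "left_adjoint_cell = \<l> (S \<odot> f\<^sub>\<star>) \<cdot> (\<epsilon> f \<lhd> (S \<odot> f\<^sub>\<star>)) \<cdot> (\<a> (f\<^sub>\<star>) (f\<^sup>\<star>) (S \<odot> f\<^sub>\<star>))\<^sup>-\<^sup>1 \<cdot>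
     (f\<^sub>\<star> \<rhd> (\<a> (f\<^sup>\<star>) S (f\<^sub>\<star>) \<cdot> (left_mate \<lhd> f\<^sub>\<star>) \<cdot> (\<a> T (f\<^sup>\<star>) (f\<^sub>\<star>))\<^sup>-\<^sup>1 \<cdot>
       (T \<rhd> star_unit C f) \<cdot> (\<r> T)\<^sup>-\<^sup>1))"
definition counit_of_core :: "'a cell" where
  "counit_of_core = \<l> S \<cdot> (\<epsilon> f \<lhd> S) \<cdot> (\<a> (f\<^sub>\<star>) (f\<^sup>\<star>) S)\<^sup>-\<^sup>1 \<cdot> (f\<^sub>\<star> \<rhd> counit_mate)"
definition unit_of_core :: "'a cell" where
  "unit_of_core = \<a> T (u\<^sub>\<star>) (f\<^sub>\<star>) \<cdot> (unit_mate \<lhd> f\<^sub>\<star>) \<cdot> star_unit C f"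

lemma sends_left_adjoint_cell:
  assumes t: "element C T x y t"
  shows "sends C left_adjoint_cell (f\<^sub>\<star> \<odot> T) (S \<odot> f\<^sub>\<star>) x (f \<bullet> y) (lift C (f\<^sub>\<star>) T t y)
    (lift C S (f\<^sub>\<star>) x (untranspose (f \<bullet> x) (core_unit_at x \<otimes>\<^sub>T t)))"
  unfolding left_adjoint_cell_def by (rule sends_left_mate core_eval t XT.element_point[OF t])+

lemma sends_counit_of_core:
  assumes a: "point C A a"
  shows "sends C counit_of_core (f\<^sub>\<star> \<odot> u\<^sub>\<star>) S a (f \<bullet> u \<bullet> a) (lift C (f\<^sub>\<star>) (u\<^sub>\<star>) a (u \<bullet> a)) (core_counit_at a)"
  unfolding counit_of_core_def by (rule sends_counit_mate core_eval a)+

lemma sends_unit_of_core: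
  assumes x: "point C X x"
  shows "sends C unit_of_core (id_span C X) (T \<odot> (u\<^sub>\<star> \<odot> f\<^sub>\<star>)) x x x
      (lift C T (u\<^sub>\<star> \<odot> f\<^sub>\<star>) (lift C (u\<^sub>\<star>) (f\<^sub>\<star>) x (f \<bullet> x)) (core_unit_at x))"
  unfolding unit_of_core_def by (rule sends_unit_mate core_eval x)+

lemma element_lower_star_hcompE:
  assumes "element C (g\<^sub>\<star> \<odot> K) x y h" "K \<in> spans C U V" "g \<in> hom C V W"
  obtains z t where "element C K x z t" "y = g \<bullet> z" "h = lift C (g\<^sub>\<star>) K t z"
  using XT.element_hcompE[OF assms(1,2) XT.lower_star_in_spans[OF assms(3)]]
    XT.element_lower_starD[OF _ assms(3)] by metis

text \<open>At this point the cells form candidate data only; the laws need one of the two conditions.\<close>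

sublocale U: functor_cell C A S \<eta>\<^sub>S \<mu>\<^sub>S X T \<eta>\<^sub>T \<mu>\<^sub>T u right_adjoint_cell
proof
  show "right_adjoint_cell \<in> cells C (u\<^sub>\<star> \<odot> S) (T \<odot> u\<^sub>\<star>)"
    by (rule XT.cells_if_sends[OF XT.hcomp_in_spans[OF AS.span u_lower]])
      (use sends_right_adjoint_cell element_lower_star_hcompE[OF _ AS.span u_arrow] in metis)
qed (fact u_arrow)

sublocale F: functor_cell C X T \<eta>\<^sub>T \<mu>\<^sub>T A S \<eta>\<^sub>S \<mu>\<^sub>S f left_adjoint_cell
proof
  show "left_adjoint_cell \<in> cells C (f\<^sub>\<star> \<odot> T) (S \<odot> f\<^sub>\<star>)"
    by (rule XT.cells_if_sends[OF XT.hcomp_in_spans[OF XT.span f_lower]])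
      (use sends_left_adjoint_cell element_lower_star_hcompE[OF _ XT.span f_arrow] in metis)
qed (fact f_arrow)

sublocale adjunction_cells C X T \<eta>\<^sub>T \<mu>\<^sub>T A S \<eta>\<^sub>S \<mu>\<^sub>S f left_adjoint_cell u right_adjoint_cell counit_of_core unit_of_core
proof
  show "counit_of_core \<in> cells C (f\<^sub>\<star> \<odot> u\<^sub>\<star>) S"
  proof (rule XT.cells_if_sends[OF XT.hcomp_in_spans[OF u_lower f_lower]])
    fix x y h assume "element C (f\<^sub>\<star> \<odot> u\<^sub>\<star>) x y h"
    then obtain z t where "element C (u\<^sub>\<star>) x z t" "y = f \<bullet> z" "h = lift C (f\<^sub>\<star>) (u\<^sub>\<star>) t z"
      by (rule element_lower_star_hcompE[OF _ u_lower f_arrow])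
    then show "\<exists>k. sends C counit_of_core (f\<^sub>\<star> \<odot> u\<^sub>\<star>) S x y h k"
      using sends_counit_of_core XT.element_lower_starD[OF _ u_arrow] by metis
  qed
  show "unit_of_core \<in> cells C (id_span C X) (T \<odot> (u\<^sub>\<star> \<odot> f\<^sub>\<star>))"
    by (rule XT.cells_if_sends[OF XT.id_span_in_spans[OF XT.obj]])
      (use sends_unit_of_core XT.element_id_spanD[OF _ XT.obj] in metis)
qed

lemma right_act:
  assumes s: "element C S a b s"
  shows "U.act s = transpose (s \<otimes>\<^sub>S core_counit_at b) (u \<bullet> b)"
  by (rule XT.lift_eq_right[OF XT.sends_unique[OF U.sends_act(1)[OF s] sends_right_adjoint_cell[OF s]]])
    (rule XT.element_rules U.element_act core_intros s AS.element_point[OF s])+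

lemma left_act:
  assumes t: "element C T x y t"
  shows "F.act t = untranspose (f \<bullet> x) (core_unit_at x \<otimes>\<^sub>T t)"
  by (rule XT.lift_eq_right[OF XT.sends_unique[OF F.sends_act(1)[OF t] sends_left_adjoint_cell[OF t]]])
    (rule XT.element_rules F.element_act core_intros t XT.element_point[OF t])+

lemma counit_at_eq: "point C A a \<Longrightarrow> counit_at a = core_counit_at a"
  using XT.sends_unique sends_counit_at sends_counit_of_core by blast

lemma unit_at_eq:
  assumes x: "point C X x" shows "unit_at x = core_unit_at x"
  by (rule XT.lift_eq_right[OF XT.sends_unique[OF sends_unit_at(1)[OF x] sends_unit_of_core[OF x]]])
    (rule XT.element_rules element_unit_at core_intros x)+

end

section \<open>Extension of a core to an adjunction\<close>

lemma (in functor_cell) cell_eqI: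
  assumes "functor_cell C X T \<eta>\<^sub>T \<mu>\<^sub>T A S \<eta>\<^sub>S \<mu>\<^sub>S f \<phi>'"
    and "\<And>x y t. element C T x y t \<Longrightarrow> act t = functor_cell.act C T S f \<phi>' t"
  shows "\<phi> = \<phi>'"
proof -
  interpret F': functor_cell C X T \<eta>\<^sub>T \<mu>\<^sub>T A S \<eta>\<^sub>S \<mu>\<^sub>S f \<phi>' by (fact assms(1))
  note L = XT.lower_star_in_spans[OF arrow]
  show ?thesis
  proof (rule XT.cells_eqI[OF XT.hcomp_in_spans[OF XT.span L]])
    fix x y h assume "element C (f\<^sub>\<star> \<odot> T) x y h"
    then obtain z t b where "element C T x z t" "element C (f\<^sub>\<star>) z y b" "h = lift C (f\<^sub>\<star>) T t b"
      using XT.element_hcompE[OF _ XT.span L] by metis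
    moreover then have "y = f \<bullet> z" "b = z" using XT.element_lower_starD[OF _ arrow] by metis+
    ultimately show "\<exists>k. sends C \<phi> (f\<^sub>\<star> \<odot> T) (S \<odot> f\<^sub>\<star>) x y h k \<and>
        sends C \<phi>' (f\<^sub>\<star> \<odot> T) (S \<odot> f\<^sub>\<star>) x y h k"
      using sends_act(1) F'.sends_act(1) assms(2) by metis
  qed
qed

context adjunction_core
begin

text \<open>Condition (I) on elements: transposition is natural in \<open>a\<close>.\<close>

definition right_compatible :: bool where
  "right_compatible \<longleftrightarrow> (\<forall>a b x s s'. element C S a b s \<longrightarrow> element C S b (f \<bullet> x) s' \<longrightarrow> point C X x \<longrightarrow>
     U.act s \<otimes>\<^sub>T transpose s' x = transpose (s \<otimes>\<^sub>S s') x)"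

text \<open>Condition (II) on elements: the inverse of transposition is natural in \<open>x\<close>.\<close>

definition left_compatible :: bool where
  "left_compatible \<longleftrightarrow> (\<forall>a y z t t'. point C A a \<longrightarrow> element C T (u \<bullet> a) y t \<longrightarrow> element C T y z t' \<longrightarrow>
     untranspose a t \<otimes>\<^sub>S F.act t' = untranspose a (t \<otimes>\<^sub>T t'))"

lemma right_compatible_iff:
  "(\<mu>\<^sub>T \<lhd> u\<^sub>\<star>) \<cdot> (\<a> T T (u\<^sub>\<star>))\<^sup>-\<^sup>1 \<cdot> (T \<rhd> right_adjoint_cell) \<cdot> \<a> T (u\<^sub>\<star>) S \<cdot> (\<pi> \<lhd> S) =
      \<pi> \<cdot> (f\<^sup>\<star> \<rhd> \<mu>\<^sub>S) \<cdot> \<a> (f\<^sup>\<star>) S S \<longleftrightarrow> right_compatible"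
  (is "?l = ?r \<longleftrightarrow> _")
proof -
  let ?P = "\<lambda>(a, b, x, s, s'). element C S a b s \<and> element C S b (f \<bullet> x) s' \<and> point C X x"
  let ?X = "\<lambda>(a, b, x, s, s'). a" and ?Y = "\<lambda>(a, b, x, s, s'). x"
    and ?H = "\<lambda>(a, b, x, s, s'). lift C (f\<^sup>\<star> \<odot> S) S s (lift C (f\<^sup>\<star>) S s' x)"
    and ?L = "\<lambda>(a, b, x, s, s'). lift C T (u\<^sub>\<star>) a (U.act s \<otimes>\<^sub>T transpose s' x)"
    and ?R = "\<lambda>(a, b, x, s, s'). lift C T (u\<^sub>\<star>) a (transpose (s \<otimes>\<^sub>S s') x)"
  note fS = XT.hcomp_in_spans[OF AS.span f_upper]
  have l: "sends C ?l ((f\<^sup>\<star> \<odot> S) \<odot> S) (T \<odot> u\<^sub>\<star>) (?X i) (?Y i) (?H i) (?L i)"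
    and r: "sends C ?r ((f\<^sup>\<star> \<odot> S) \<odot> S) (T \<odot> u\<^sub>\<star>) (?X i) (?Y i) (?H i) (?R i)"
    if "i = (a, b, x, s, s')" "element C S a b s" "element C S b (f \<bullet> x) s'" "point C X x" for i a b x s s'
    unfolding that(1) prod.case
    by (rule U.sends_act U.element_act core_eval that(2-) AS.element_point[OF that(2)])+
  have "?l = ?r \<longleftrightarrow> (\<forall>i. ?P i \<longrightarrow> ?L i = ?R i)"
  proof (rule XT.cells_eq_iff[where X = ?X and Y = ?Y and H = ?H])
    show "(f\<^sup>\<star> \<odot> S) \<odot> S \<in> spans C A X" by (rule XT.hcomp_in_spans[OF AS.span fS])
  next
    fix a x h assume "element C ((f\<^sup>\<star> \<odot> S) \<odot> S) a x h"
    then obtain b s q where s: "element C S a b s" "element C (f\<^sup>\<star> \<odot> S) b x q" "h = lift C (f\<^sup>\<star> \<odot> S) S s q"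
      using XT.element_hcompE[OF _ AS.span fS] by metis
    obtain c s' d where q: "element C S b c s'" "element C (f\<^sup>\<star>) c x d" "q = lift C (f\<^sup>\<star>) S s' d"
      using XT.element_hcompE[OF s(2) AS.span f_upper] by metis
    have "?P (a, b, x, s, s') \<and> a = ?X (a, b, x, s, s') \<and> x = ?Y (a, b, x, s, s') \<and> h = ?H (a, b, x, s, s')"
      using s q XT.element_upper_starD[OF q(2) f_arrow] by simp
    then show "\<exists>i. ?P i \<and> a = ?X i \<and> x = ?Y i \<and> h = ?H i" by (rule exI)
  qed (use l r in auto)
  also have "\<dots> \<longleftrightarrow> right_compatible"
  proof -
    have "?L (a, b, x, s, s') = ?R (a, b, x, s, s') \<longleftrightarrow> U.act s \<otimes>\<^sub>T transpose s' x = transpose (s \<otimes>\<^sub>S s') x"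
      if t: "element C S a b s" "element C S b (f \<bullet> x) s'" "point C X x" for a b x s s'
      unfolding prod.case
      by (rule XT.lift_eq_iff) (rule XT.element_rules U.element_act core_intros t AS.element_point[OF t(1)])+
    then show ?thesis unfolding right_compatible_def by auto
  qed
  finally show ?thesis .
qed

lemma left_compatible_iff:
  "(f\<^sup>\<star> \<rhd> \<mu>\<^sub>S) \<cdot> \<a> (f\<^sup>\<star>) S S \<cdot> (left_mate \<lhd> S) \<cdot> (\<a> T (f\<^sup>\<star>) S)\<^sup>-\<^sup>1 \<cdot> (T \<rhd> \<pi>\<^sup>-\<^sup>1) =
      \<pi>\<^sup>-\<^sup>1 \<cdot> (\<mu>\<^sub>T \<lhd> u\<^sub>\<star>) \<cdot> (\<a> T T (u\<^sub>\<star>))\<^sup>-\<^sup>1 \<longleftrightarrow> left_compatible"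
  (is "?l = ?r \<longleftrightarrow> _")
proof -
  let ?P = "\<lambda>(a, y, z, t, t'). point C A a \<and> element C T (u \<bullet> a) y t \<and> element C T y z t'"
  let ?X = "\<lambda>(a, y, z, t, t'). a" and ?Y = "\<lambda>(a, y, z, t, t'). z"
    and ?H = "\<lambda>(a, y, z, t, t'). lift C T (T \<odot> u\<^sub>\<star>) (lift C T (u\<^sub>\<star>) a t) t'"
    and ?L = "\<lambda>(a, y, z, t, t'). lift C (f\<^sup>\<star>) S (untranspose a t \<otimes>\<^sub>S F.act t') z"
    and ?R = "\<lambda>(a, y, z, t, t'). lift C (f\<^sup>\<star>) S (untranspose a (t \<otimes>\<^sub>T t')) z"
  note Tu = XT.hcomp_in_spans[OF u_lower XT.span]
  have left_mate: "sends C left_mate (T \<odot> f\<^sup>\<star>) (f\<^sup>\<star> \<odot> S) (f \<bullet> x) y (lift C T (f\<^sup>\<star>) x t)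
    (lift C (f\<^sup>\<star>) S (F.act t) y)" if "element C T x y t" for x y t
    using sends_left_mate[OF that] left_act[OF that] by simp
  have l: "sends C ?l (T \<odot> (T \<odot> u\<^sub>\<star>)) (f\<^sup>\<star> \<odot> S) (?X i) (?Y i) (?H i) (?L i)"
    and r: "sends C ?r (T \<odot> (T \<odot> u\<^sub>\<star>)) (f\<^sup>\<star> \<odot> S) (?X i) (?Y i) (?H i) (?R i)"
    if "i = (a, y, z, t, t')" "point C A a" "element C T (u \<bullet> a) y t" "element C T y z t'" for i a y z t t'
    unfolding that(1) prod.case
    by (rule left_mate F.element_act core_eval that(2-) XT.element_point[OF that(3)] XT.element_point[OF that(4)])+
  have "?l = ?r \<longleftrightarrow> (\<forall>i. ?P i \<longrightarrow> ?L i = ?R i)"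
  proof (rule XT.cells_eq_iff[where X = ?X and Y = ?Y and H = ?H])
    show "T \<odot> (T \<odot> u\<^sub>\<star>) \<in> spans C A X" by (rule XT.hcomp_in_spans[OF Tu XT.span])
  next
    fix a z h assume "element C (T \<odot> (T \<odot> u\<^sub>\<star>)) a z h"
    then obtain y q t' where t: "element C (T \<odot> u\<^sub>\<star>) a y q" "element C T y z t'" "h = lift C T (T \<odot> u\<^sub>\<star>) q t'"
      using XT.element_hcompE[OF _ Tu XT.span] by metis
    obtain c b t where q: "element C (u\<^sub>\<star>) a c b" "element C T c y t" "q = lift C T (u\<^sub>\<star>) b t"
      using XT.element_hcompE[OF t(1) u_lower XT.span] by metis
    have "?P (a, y, z, t, t') \<and> a = ?X (a, y, z, t, t') \<and> z = ?Y (a, y, z, t, t') \<and> h = ?H (a, y, z, t, t')"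
      using t q XT.element_lower_starD[OF q(1) u_arrow] by simp
    then show "\<exists>i. ?P i \<and> a = ?X i \<and> z = ?Y i \<and> h = ?H i" by (rule exI)
  qed (use l r in auto)
  also have "\<dots> \<longleftrightarrow> left_compatible"
  proof -
    have "?L (a, y, z, t, t') = ?R (a, y, z, t, t') \<longleftrightarrow>
        untranspose a t \<otimes>\<^sub>S F.act t' = untranspose a (t \<otimes>\<^sub>T t')"
      if t: "point C A a" "element C T (u \<bullet> a) y t" "element C T y z t'" for a y z t t'
    proof -
      note z = XT.element_upper_star[OF f_arrow XT.element_point(2)[OF t(3)]]
      have e: "element C S a (f \<bullet> z) (untranspose a t \<otimes>\<^sub>S F.act t')"
          "element C S a (f \<bullet> z) (untranspose a (t \<otimes>\<^sub>T t'))"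
        by (rule F.element_act core_intros t)+
      show ?thesis using XT.pr0_lift[OF e(1) z] XT.pr0_lift[OF e(2) z] unfolding prod.case by metis
    qed
    then show ?thesis unfolding left_compatible_def by auto
  qed
  finally show ?thesis .
qed

text \<open>Applying (II) to identities gives \<open>\<pi>\<^sup>-\<^sup>1(t) = counit \<cdot> f t\<close>. Hence both sides of (I) have the same
  image under \<open>\<pi>\<^sup>-\<^sup>1\<close>: \<open>\<pi>\<^sup>-\<^sup>1(u s \<cdot> \<pi>(s')) = \<pi>\<^sup>-\<^sup>1(u s) \<cdot> f(\<pi>(s')) = s \<cdot> counit \<cdot> f(\<pi>(s')) = s s'\<close>.\<close>

lemma left_compatible_imp_right_compatible:
  assumes left_compatible
  shows right_compatible
  unfolding right_compatible_def
proof (intro allI impI)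
  fix a b x s s'
  assume s: "element C S a b s" and s': "element C S b (f \<bullet> x) s'" and x: "point C X x"
  note a = AS.element_point(1)[OF s] and b = AS.element_point(2)[OF s]
  have II: "untranspose a t \<otimes>\<^sub>S F.act t' = untranspose a (t \<otimes>\<^sub>T t')"
    if "point C A a" "element C T (u \<bullet> a) y t" "element C T y z t'" for a y z t t'
    using assms that unfolding left_compatible_def by blast
  note p = element_transpose[OF s' x] and eps = element_core_counit_at[OF b]
  note sc = AS.element_times[OF s eps]
  have counit: "core_counit_at b \<otimes>\<^sub>S F.act (transpose s' x) = s'"
  proof -
    have "core_counit_at b \<otimes>\<^sub>S F.act (transpose s' x) = untranspose b (XT.one (u \<bullet> b) \<otimes>\<^sub>T transpose s' x)"
      unfolding core_counit_at_def by (rule II[OF b XT.element_one[OF u_point[OF b]] p])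
    then show ?thesis using XT.one_times[OF p] untranspose_transpose[OF s' x] by simp
  qed
  have U: "untranspose a (U.act s) = s \<otimes>\<^sub>S core_counit_at b"
    unfolding right_act[OF s] by (rule untranspose_transpose[OF sc u_point[OF b]])
  have "untranspose a (U.act s \<otimes>\<^sub>T transpose s' x) = untranspose a (U.act s) \<otimes>\<^sub>S F.act (transpose s' x)"
    by (rule II[OF a U.element_act[OF s] p, symmetric])
  also have "\<dots> = s \<otimes>\<^sub>S s'"
    unfolding U AS.times_assoc[OF s eps F.element_act[OF p]] counit ..
  finally show "U.act s \<otimes>\<^sub>T transpose s' x = transpose (s \<otimes>\<^sub>S s') x"
    using transpose_untranspose[OF XT.element_times[OF U.element_act[OF s] p] a] by metis
qed

text \<open>Under (I) the unit components are universal arrows: \<open>\<pi>(s) = u s \<cdot> unit\<close> with \<open>\<pi>\<close> bijective. The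
  action of \<open>f\<close> on \<open>t : y \<rightarrow> x\<close> is thus determined by \<open>u (f t) \<cdot> unit = unit \<cdot> t\<close>, and laws concerning
  arrows with source \<open>f x\<close> are checked after transposing.\<close>

lemma right_compatible_imp_adjunction:
  assumes right_compatible
  shows "elementwise_adjunction C X T \<eta>\<^sub>T \<mu>\<^sub>T A S \<eta>\<^sub>S \<mu>\<^sub>S f left_adjoint_cell u right_adjoint_cell counit_of_core unit_of_core"
    and "associated_core C T \<mu>\<^sub>T S f u right_adjoint_cell unit_of_core = \<pi>"
proof -
  have I: "transpose (s \<otimes>\<^sub>S s') x = U.act s \<otimes>\<^sub>T transpose s' x"
    if "element C S a b s" "element C S b (f \<bullet> x) s'" "point C X x" for a b x s s'
    using assms that unfolding right_compatible_def by metis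
  note eta = element_core_unit_at and eps = element_core_counit_at
  have transpose: "transpose s x = U.act s \<otimes>\<^sub>T core_unit_at x"
    if s: "element C S a (f \<bullet> x) s" and x: "point C X x" for a x s
    using I[OF s AS.element_one[OF f_point[OF x]] x] AS.times_one[OF s] by (simp add: core_unit_at_def)
  have U_mult: "U.act s \<otimes>\<^sub>T U.act s' = U.act (s \<otimes>\<^sub>S s')"
    if s: "element C S a b s" "element C S b c s'" for a b c s s'
  proof -
    note c = AS.element_point(2)[OF s(2)]
    show ?thesis
      using I[OF s(1) AS.element_times[OF s(2) eps[OF c]] u_point[OF c]]
        right_act[OF s(2)] right_act[OF AS.element_times[OF s]] AS.times_assoc[OF s eps[OF c]] by simp
  qed
  have U_one: "U.act (AS.one a) = XT.one (u \<bullet> a)" if a: "point C A a" for a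
    using right_act[OF AS.element_one[OF a]] AS.one_times[OF eps[OF a]] transpose_counit[OF a] by simp
  \<comment> \<open>The defining property of \<open>f t\<close> by universality of the unit, which is also naturality of the unit.\<close>
  have U_F: "U.act (F.act t) \<otimes>\<^sub>T core_unit_at y = core_unit_at x \<otimes>\<^sub>T t"
    if t: "element C T x y t" for x y t
  proof -
    note x = XT.element_point(1)[OF t] and y = XT.element_point(2)[OF t]
    have "transpose (F.act t) y = core_unit_at x \<otimes>\<^sub>T t"
      unfolding left_act[OF t]
      by (rule transpose_untranspose[OF XT.element_times[OF eta[OF x] t] f_point[OF x]])
    then show ?thesis using transpose[OF F.element_act[OF t] y] by simp
  qed
  have F_mult: "F.act t \<otimes>\<^sub>S F.act t' = F.act (t \<otimes>\<^sub>T t')"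
    if t: "element C T x y t" "element C T y z t'" for x y z t t'
  proof (rule transpose_inject)
    note x = XT.element_point(1)[OF t(1)] and y = XT.element_point(1)[OF t(2)]
    show z: "point C X z" by (rule XT.element_point(2)[OF t(2)])
    note F = t[THEN F.element_act]
    note UF = F[THEN U.element_act]
    show e: "element C S (f \<bullet> x) (f \<bullet> z) (F.act t \<otimes>\<^sub>S F.act t')"
      "element C S (f \<bullet> x) (f \<bullet> z) (F.act (t \<otimes>\<^sub>T t'))"
      by (rule F.element_act core_intros t)+
    have "transpose (F.act t \<otimes>\<^sub>S F.act t') z = U.act (F.act t) \<otimes>\<^sub>T (U.act (F.act t') \<otimes>\<^sub>T core_unit_at z)"
      using transpose[OF e(1) z] U_mult[OF F] XT.times_assoc[OF UF eta[OF z]] by simp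
    also have "\<dots> = (U.act (F.act t) \<otimes>\<^sub>T core_unit_at y) \<otimes>\<^sub>T t'"
      unfolding U_F[OF t(2)] by (rule XT.times_assoc[OF UF(1) eta[OF y] t(2), symmetric])
    also have "\<dots> = core_unit_at x \<otimes>\<^sub>T (t \<otimes>\<^sub>T t')"
      unfolding U_F[OF t(1)] by (rule XT.times_assoc[OF eta[OF x] t])
    also have "\<dots> = transpose (F.act (t \<otimes>\<^sub>T t')) z"
      using transpose[OF e(2) z] U_F[OF XT.element_times[OF t]] by simp
    finally show "transpose (F.act t \<otimes>\<^sub>S F.act t') z = transpose (F.act (t \<otimes>\<^sub>T t')) z" .
  qed
  have F_one: "F.act (XT.one x) = AS.one (f \<bullet> x)" if x: "point C X x" for x
    using left_act[OF XT.element_one[OF x]] XT.times_one[OF eta[OF x]] untranspose_unit[OF x] by simp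
  have counit_nat: "s \<otimes>\<^sub>S core_counit_at b = core_counit_at a \<otimes>\<^sub>S F.act (U.act s)"
    if s: "element C S a b s" for a b s
  proof (rule transpose_inject)
    note a = AS.element_point(1)[OF s] and b = AS.element_point(2)[OF s]
    show "point C X (u \<bullet> b)" by (rule u_point[OF b])
    note U = U.element_act[OF s]
    note F = F.element_act[OF U]
    show e: "element C S a (f \<bullet> u \<bullet> b) (s \<otimes>\<^sub>S core_counit_at b)"
      "element C S a (f \<bullet> u \<bullet> b) (core_counit_at a \<otimes>\<^sub>S F.act (U.act s))"
      by (rule F U core_intros s a b)+
    have "transpose (core_counit_at a \<otimes>\<^sub>S F.act (U.act s)) (u \<bullet> b) =
        U.act (core_counit_at a) \<otimes>\<^sub>T (U.act (F.act (U.act s)) \<otimes>\<^sub>T core_unit_at (u \<bullet> b))"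
      unfolding I[OF eps[OF a] F u_point[OF b]] transpose[OF F u_point[OF b]] ..
    also have "\<dots> = (U.act (core_counit_at a) \<otimes>\<^sub>T core_unit_at (u \<bullet> a)) \<otimes>\<^sub>T U.act s"
      unfolding U_F[OF U]
      by (rule XT.times_assoc[OF U.element_act[OF eps[OF a]] eta[OF u_point[OF a]] U, symmetric])
    also have "\<dots> = U.act s"
      unfolding transpose[OF eps[OF a] u_point[OF a], symmetric] transpose_counit[OF a]
      by (rule XT.one_times[OF U])
    finally show "transpose (s \<otimes>\<^sub>S core_counit_at b) (u \<bullet> b) =
        transpose (core_counit_at a \<otimes>\<^sub>S F.act (U.act s)) (u \<bullet> b)"
      unfolding right_act[OF s] ..
  qed
  have triangle_U: "U.act (core_counit_at a) \<otimes>\<^sub>T core_unit_at (u \<bullet> a) = XT.one (u \<bullet> a)"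
    if a: "point C A a" for a
    using transpose[OF eps[OF a] u_point[OF a]] transpose_counit[OF a] by simp
  have triangle_F: "AS.one (f \<bullet> x) = core_counit_at (f \<bullet> x) \<otimes>\<^sub>S F.act (core_unit_at x)"
    if x: "point C X x" for x
  proof (rule transpose_inject[OF _ _ _ x])
    note a = f_point[OF x]
    note ua = u_point[OF a]
    note F = F.element_act[OF eta[OF x]]
    show "element C S (f \<bullet> x) (f \<bullet> x) (AS.one (f \<bullet> x))"
      "element C S (f \<bullet> x) (f \<bullet> x) (core_counit_at (f \<bullet> x) \<otimes>\<^sub>S F.act (core_unit_at x))"
      by (rule F core_intros x)+
    have "transpose (core_counit_at (f \<bullet> x) \<otimes>\<^sub>S F.act (core_unit_at x)) x =
        U.act (core_counit_at (f \<bullet> x)) \<otimes>\<^sub>T (core_unit_at (u \<bullet> f \<bullet> x) \<otimes>\<^sub>T core_unit_at x)"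
      unfolding I[OF eps[OF a] F x] transpose[OF F x] U_F[OF eta[OF x]] ..
    also have "\<dots> = XT.one (u \<bullet> f \<bullet> x) \<otimes>\<^sub>T core_unit_at x"
      unfolding triangle_U[OF a, symmetric]
      by (rule XT.times_assoc[OF U.element_act[OF eps[OF a]] eta[OF ua] eta[OF x], symmetric])
    also have "\<dots> = transpose (AS.one (f \<bullet> x)) x"
      unfolding XT.one_times[OF eta[OF x]] by (rule core_unit_at_def)
    finally show "transpose (AS.one (f \<bullet> x)) x =
        transpose (core_counit_at (f \<bullet> x) \<otimes>\<^sub>S F.act (core_unit_at x)) x" ..
  qed
  show "elementwise_adjunction C X T \<eta>\<^sub>T \<mu>\<^sub>T A S \<eta>\<^sub>S \<mu>\<^sub>S f left_adjoint_cell u right_adjoint_cell counit_of_core unit_of_core"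
  proof unfold_locales
    fix a b s assume s: "element C S a b s"
    show "s \<otimes>\<^sub>S counit_at b = counit_at a \<otimes>\<^sub>S F.act (U.act s)"
      using counit_nat[OF s] counit_at_eq AS.element_point[OF s] by simp
  next
    fix x y t assume t: "element C T x y t"
    show "unit_at x \<otimes>\<^sub>T t = U.act (F.act t) \<otimes>\<^sub>T unit_at y"
      using U_F[OF t] unit_at_eq XT.element_point[OF t] by simp
  next
    fix x assume x: "point C X x"
    show "AS.one (f \<bullet> x) = counit_at (f \<bullet> x) \<otimes>\<^sub>S F.act (unit_at x)"
      using triangle_F[OF x] counit_at_eq[OF f_point[OF x]] unit_at_eq[OF x] by simp
  next
    fix a assume a: "point C A a"
    show "XT.one (u \<bullet> a) = U.act (counit_at a) \<otimes>\<^sub>T unit_at (u \<bullet> a)"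
      using triangle_U[OF a] counit_at_eq[OF a] unit_at_eq[OF u_point[OF a]] by simp
  qed (fact F_mult F_one U_mult U_one)+
  show "associated_core C T \<mu>\<^sub>T S f u right_adjoint_cell unit_of_core = \<pi>"
  proof (rule XT.cells_eqI[OF XT.hcomp_in_spans[OF AS.span f_upper]])
    fix a x h assume "element C (f\<^sup>\<star> \<odot> S) a x h"
    then obtain c s d where q: "element C S a c s" "element C (f\<^sup>\<star>) c x d" "h = lift C (f\<^sup>\<star>) S s d"
      using XT.element_hcompE[OF _ AS.span f_upper] by metis
    note x = XT.element_upper_starD[OF q(2) f_arrow]
    have s: "element C S a (f \<bullet> x) s" and h: "h = lift C (f\<^sup>\<star>) S s x" using q x by auto
    have "U.act s \<otimes>\<^sub>T unit_at x = transpose s x"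
      using transpose[OF s x(1)] unit_at_eq[OF x(1)] by simp
    then show "\<exists>k. sends C (associated_core C T \<mu>\<^sub>T S f u right_adjoint_cell unit_of_core) (f\<^sup>\<star> \<odot> S) (T \<odot> u\<^sub>\<star>) a x h k
        \<and> sends C \<pi> (f\<^sup>\<star> \<odot> S) (T \<odot> u\<^sub>\<star>) a x h k"
      using sends_associated_core[OF s x(1)] sends_core(1)[OF s x(1)] unfolding h by auto
  qed
qed

text \<open>The starting point is \<open>\<pi>(s) = u s \<cdot> unit\<close>, now for the given adjunction. Taking for \<open>s\<close> an identity,
  a counit component, \<open>s' \<cdot> counit\<close> and \<open>f t\<close> in turn identifies the unit, the counit and both
  functors; functoriality of \<open>u\<close> gives (I).\<close>

lemma extension_determined:
  assumes adj: "elementwise_adjunction C X T \<eta>\<^sub>T \<mu>\<^sub>T A S \<eta>\<^sub>S \<mu>\<^sub>S f \<phi> u \<upsilon> \<alpha> \<beta>"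
    and core: "associated_core C T \<mu>\<^sub>T S f u \<upsilon> \<beta> = \<pi>"
  shows "\<phi> = left_adjoint_cell" "\<upsilon> = right_adjoint_cell" "\<alpha> = counit_of_core" "\<beta> = unit_of_core" right_compatible
proof -
  interpret E: elementwise_adjunction C X T \<eta>\<^sub>T \<mu>\<^sub>T A S \<eta>\<^sub>S \<mu>\<^sub>S f \<phi> u \<upsilon> \<alpha> \<beta> by (fact adj)
  have transpose: "transpose s x = E.U.act s \<otimes>\<^sub>T E.unit_at x"
    if s: "element C S a (f \<bullet> x) s" and x: "point C X x" for a x s
    by (rule XT.lift_eq_right[OF XT.sends_unique[OF sends_core(1)[OF s x]
            E.sends_associated_core[OF s x, unfolded core]]])
      (rule XT.element_rules core_intros E.U.element_act E.element_unit_at s x AS.element_point[OF s])+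
  have unit: "E.unit_at x = core_unit_at x" if x: "point C X x" for x
    using transpose[OF AS.element_one[OF f_point[OF x]] x] E.U_one[OF f_point[OF x]]
      XT.one_times[OF E.element_unit_at[OF x]] by (simp add: core_unit_at_def)
  have counit: "E.counit_at a = core_counit_at a" if a: "point C A a" for a
    using transpose[OF E.element_counit_at[OF a] u_point[OF a]] E.triangle_U[OF a]
      transpose_counit[OF a] transpose_inject[OF _ E.element_counit_at[OF a] element_core_counit_at[OF a]
        u_point[OF a]] by simp
  have U: "E.U.act s = U.act s" if s: "element C S a b s" for a b s
  proof -
    note b = AS.element_point(2)[OF s]
    note e = E.element_counit_at[OF b]
    have "U.act s = E.U.act (s \<otimes>\<^sub>S E.counit_at b) \<otimes>\<^sub>T E.unit_at (u \<bullet> b)"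
      unfolding right_act[OF s] counit[OF b, symmetric]
      by (rule transpose[OF AS.element_times[OF s e] u_point[OF b]])
    also have "\<dots> = E.U.act s \<otimes>\<^sub>T (E.U.act (E.counit_at b) \<otimes>\<^sub>T E.unit_at (u \<bullet> b))"
      unfolding E.U_mult[OF s e, symmetric]
      by (rule XT.times_assoc[OF E.U.element_act[OF s] E.U.element_act[OF e]
            E.element_unit_at[OF u_point[OF b]]])
    also have "\<dots> = E.U.act s"
      unfolding E.triangle_U[OF b, symmetric] by (rule XT.times_one[OF E.U.element_act[OF s]])
    finally show ?thesis ..
  qed
  have F: "E.F.act t = F.act t" if t: "element C T x y t" for x y t
  proof -
    note x = XT.element_point(1)[OF t] and y = XT.element_point(2)[OF t]
    note e = E.F.element_act[OF t]
    have "transpose (E.F.act t) y = core_unit_at x \<otimes>\<^sub>T t"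
      using transpose[OF e y] E.unit_nat[OF t] unit[OF x] by simp
    then show ?thesis
      using left_act[OF t] untranspose_transpose[OF e y] by simp
  qed
  show "\<phi> = left_adjoint_cell"
    by (rule E.F.cell_eqI[OF F.functor_cell_axioms F])
  show "\<upsilon> = right_adjoint_cell"
    by (rule E.U.cell_eqI[OF U.functor_cell_axioms U])
  show "\<alpha> = counit_of_core"
  proof (rule XT.cells_eqI[OF XT.hcomp_in_spans[OF u_lower f_lower]])
    fix x y h assume "element C (f\<^sub>\<star> \<odot> u\<^sub>\<star>) x y h"
    then obtain z t where zt: "element C (u\<^sub>\<star>) x z t" "y = f \<bullet> z" "h = lift C (f\<^sub>\<star>) (u\<^sub>\<star>) t z"
      by (rule element_lower_star_hcompE[OF _ u_lower f_arrow])
    note x = XT.element_lower_starD[OF zt(1) u_arrow]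
    show "\<exists>k. sends C \<alpha> (f\<^sub>\<star> \<odot> u\<^sub>\<star>) S x y h k \<and> sends C counit_of_core (f\<^sub>\<star> \<odot> u\<^sub>\<star>) S x y h k"
      using E.sends_counit_at[OF x(1)] sends_counit_of_core[OF x(1)] counit[OF x(1)] zt x by auto
  qed
  show "\<beta> = unit_of_core"
  proof (rule XT.cells_eqI[OF XT.id_span_in_spans[OF XT.obj]])
    fix x y h assume "element C (id_span C X) x y h"
    note x = XT.element_id_spanD[OF this XT.obj]
    show "\<exists>k. sends C \<beta> (id_span C X) (T \<odot> (u\<^sub>\<star> \<odot> f\<^sub>\<star>)) x y h k \<and>
        sends C unit_of_core (id_span C X) (T \<odot> (u\<^sub>\<star> \<odot> f\<^sub>\<star>)) x y h k"
      using E.sends_unit_at(1)[OF x(3)] sends_unit_of_core[OF x(3)] unit[OF x(3)] x by auto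
  qed
  show right_compatible
    unfolding right_compatible_def
  proof (intro allI impI)
    fix a b x s s'
    assume s: "element C S a b s" and s': "element C S b (f \<bullet> x) s'" and x: "point C X x"
    show "U.act s \<otimes>\<^sub>T transpose s' x = transpose (s \<otimes>\<^sub>S s') x"
      using transpose[OF s' x] transpose[OF AS.element_times[OF s s'] x] E.U_mult[OF s s'] U[OF s]
        XT.times_assoc[OF E.U.element_act[OF s] E.U.element_act[OF s'] E.element_unit_at[OF x]] by simp
  qed
qed

lemma core_extends_to_iff:
  "core_extends_to C X T \<eta>\<^sub>T \<mu>\<^sub>T A S \<eta>\<^sub>S \<mu>\<^sub>S f u \<pi> \<phi> \<upsilon> \<alpha> \<beta> \<longleftrightarrow>
    right_compatible \<and> \<phi> = left_adjoint_cell \<and> \<upsilon> = right_adjoint_cell \<and> \<alpha> = counit_of_core \<and> \<beta> = unit_of_core"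
proof
  assume ext: "core_extends_to C X T \<eta>\<^sub>T \<mu>\<^sub>T A S \<eta>\<^sub>S \<mu>\<^sub>S f u \<pi> \<phi> \<upsilon> \<alpha> \<beta>"
  then have adj: "internal_adjunction C X T \<eta>\<^sub>T \<mu>\<^sub>T A S \<eta>\<^sub>S \<mu>\<^sub>S f \<phi> u \<upsilon> \<alpha> \<beta>"
    and core: "associated_core C T \<mu>\<^sub>T S f u \<upsilon> \<beta> = \<pi>" by (simp_all add: core_extends_to_def)
  have "elementwise_adjunction C X T \<eta>\<^sub>T \<mu>\<^sub>T A S \<eta>\<^sub>S \<mu>\<^sub>S f \<phi> u \<upsilon> \<alpha> \<beta>"
    using adjunction_cells.internal_adjunction_iff[OF internal_adjunction_cells[OF adj]] adj by simp
  then show "right_compatible \<and> \<phi> = left_adjoint_cell \<and> \<upsilon> = right_adjoint_cell \<and> \<alpha> = counit_of_core \<and> \<beta> = unit_of_core"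
    using extension_determined core by blast
next
  assume "right_compatible \<and> \<phi> = left_adjoint_cell \<and> \<upsilon> = right_adjoint_cell \<and> \<alpha> = counit_of_core \<and> \<beta> = unit_of_core"
  then show "core_extends_to C X T \<eta>\<^sub>T \<mu>\<^sub>T A S \<eta>\<^sub>S \<mu>\<^sub>S f u \<pi> \<phi> \<upsilon> \<alpha> \<beta>"
    using right_compatible_imp_adjunction internal_adjunction_iff by (simp add: core_extends_to_def)
qed

end

theorem corollary8:
  fixes C :: "('o, 'a, 'm) pb_category_scheme" (structure)
    and X A :: 'o and T S :: "'a span" and \<eta>\<^sub>T \<mu>\<^sub>T \<eta>\<^sub>S \<mu>\<^sub>S :: "'a cell"
    and f u :: 'a and \<pi> \<beta>' \<alpha>' \<upsilon> \<psi> :: "'a cell" and I II :: bool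
  assumes "category_with_pullbacks C"
    and "internal_category C A S \<eta>\<^sub>S \<mu>\<^sub>S"
    and "internal_category C X T \<eta>\<^sub>T \<mu>\<^sub>T"
    and "f \<in> hom C X A"
    and "u \<in> hom C A X"
    and "\<pi> \<in> cells C (f\<^sup>\<star> \<odot> S) (T \<odot> u\<^sub>\<star>)"
    and "invertible_cell C \<pi>"
    and "\<beta>' = \<pi> \<cdot> (f\<^sup>\<star> \<rhd> \<eta>\<^sub>S) \<cdot> (\<r> (f\<^sup>\<star>))\<^sup>-\<^sup>1"
    and "\<alpha>' = \<pi>\<^sup>-\<^sup>1 \<cdot> (\<eta>\<^sub>T \<lhd> u\<^sub>\<star>) \<cdot> (\<l> (u\<^sub>\<star>))\<^sup>-\<^sup>1"
    and "\<upsilon> = \<pi> \<cdot> (f\<^sup>\<star> \<rhd> \<mu>\<^sub>S) \<cdot> \<a> (f\<^sup>\<star>) S S \<cdot> (\<alpha>' \<lhd> S)"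
    and "\<psi> = \<pi>\<^sup>-\<^sup>1 \<cdot> (\<mu>\<^sub>T \<lhd> u\<^sub>\<star>) \<cdot> (\<a> T T (u\<^sub>\<star>))\<^sup>-\<^sup>1 \<cdot> (T \<rhd> \<beta>')"
    and "I \<longleftrightarrow>
      (\<mu>\<^sub>T \<lhd> u\<^sub>\<star>) \<cdot> (\<a> T T (u\<^sub>\<star>))\<^sup>-\<^sup>1 \<cdot> (T \<rhd> \<upsilon>) \<cdot> \<a> T (u\<^sub>\<star>) S \<cdot> (\<pi> \<lhd> S) =
      \<pi> \<cdot> (f\<^sup>\<star> \<rhd> \<mu>\<^sub>S) \<cdot> \<a> (f\<^sup>\<star>) S S"
    and "II \<longleftrightarrow>
      (f\<^sup>\<star> \<rhd> \<mu>\<^sub>S) \<cdot> \<a> (f\<^sup>\<star>) S S \<cdot> (\<psi> \<lhd> S) \<cdot> (\<a> T (f\<^sup>\<star>) S)\<^sup>-\<^sup>1 \<cdot> (T \<rhd> \<pi>\<^sup>-\<^sup>1) =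
      \<pi>\<^sup>-\<^sup>1 \<cdot> (\<mu>\<^sub>T \<lhd> u\<^sub>\<star>) \<cdot> (\<a> T T (u\<^sub>\<star>))\<^sup>-\<^sup>1"
  shows "((\<exists>\<phi> \<alpha> \<beta>. core_extends_to C X T \<eta>\<^sub>T \<mu>\<^sub>T A S \<eta>\<^sub>S \<mu>\<^sub>S f u \<pi> \<phi> \<upsilon> \<alpha> \<beta>) \<longleftrightarrow> I \<or> II) \<and>
    ((\<exists>\<phi> \<upsilon>' \<alpha> \<beta>. core_extends_to C X T \<eta>\<^sub>T \<mu>\<^sub>T A S \<eta>\<^sub>S \<mu>\<^sub>S f u \<pi> \<phi> \<upsilon>' \<alpha> \<beta>) \<longleftrightarrow> I \<or> II) \<and>
    (\<forall>\<phi>\<^sub>1 \<upsilon>\<^sub>1 \<alpha>\<^sub>1 \<beta>\<^sub>1 \<phi>\<^sub>2 \<upsilon>\<^sub>2 \<alpha>\<^sub>2 \<beta>\<^sub>2.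
      core_extends_to C X T \<eta>\<^sub>T \<mu>\<^sub>T A S \<eta>\<^sub>S \<mu>\<^sub>S f u \<pi> \<phi>\<^sub>1 \<upsilon>\<^sub>1 \<alpha>\<^sub>1 \<beta>\<^sub>1 \<longrightarrow>
      core_extends_to C X T \<eta>\<^sub>T \<mu>\<^sub>T A S \<eta>\<^sub>S \<mu>\<^sub>S f u \<pi> \<phi>\<^sub>2 \<upsilon>\<^sub>2 \<alpha>\<^sub>2 \<beta>\<^sub>2 \<longrightarrow>
      \<phi>\<^sub>1 = \<phi>\<^sub>2 \<and> \<upsilon>\<^sub>1 = \<upsilon>\<^sub>2 \<and> \<alpha>\<^sub>1 = \<alpha>\<^sub>2 \<and> \<beta>\<^sub>1 = \<beta>\<^sub>2)"
proof -
  interpret core: adjunction_core C X T \<eta>\<^sub>T \<mu>\<^sub>T A S \<eta>\<^sub>S \<mu>\<^sub>S f u \<pi>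
    using assms(2-7) by (simp add: adjunction_core_def internal_category_pair_def adjunction_core_axioms_def)
  have "\<upsilon> = core.right_adjoint_cell"
    unfolding core.right_adjoint_cell_def core.counit_mate_def assms(9,10) ..
  moreover have "\<psi> = core.left_mate"
    unfolding core.left_mate_def core.unit_mate_def assms(8,11) ..
  ultimately have "I \<longleftrightarrow> core.right_compatible" "II \<longleftrightarrow> core.left_compatible"
    unfolding assms(12,13) by (simp_all only: core.right_compatible_iff core.left_compatible_iff)
  then have "I \<or> II \<longleftrightarrow> core.right_compatible"
    using core.left_compatible_imp_right_compatible by blast
  then show ?thesis
    unfolding core.core_extends_to_iff \<open>\<upsilon> = core.right_adjoint_cell\<close> by blast
qed

end
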